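(* Let $c>0$ be a real number and let $n\ge 0$ be an integer. Then $$\lambda_n^{(\alpha)}(c)\le \lambda_n^{(\alpha')}(c)\qquad\text{for all real numbers } \alpha\ge\alpha'\ge 0 .$$
   Context: For a real number $\alpha>-1$ and $c>0$, let $I=[-1,1]$ and $\omega_\alpha(y)=(1-y^2)^\alpha$. The weighted finite Fourier transform is the operator on $L^2(I,\omega_\alpha)=L^2(I,\omega_\alpha(y)\,dy)$ given by $\mathcal F_c^{(\alpha)}f(x)=\int_{-1}^1 e^{icxy}f(y)\,\omega_\alpha(y)\,dy$. It commutes with the differential operator $\mathcal L_c^{(\alpha,\alpha)}\varphi(x)=(1-x^2)\varphi''(x)-(2\alpha+2)x\varphi'(x)-c^2x^2\varphi(x)$ on $C^2([-1,1])$. The generalized prolate spheroidal wave functions (GPSWFs) $\psi_{n,c}^{(\alpha)}$, $n\ge0$, are the common eigenfunctions: they are the real-valued $C^2([-1,1])$ eigenfunctions of $-\mathcal L_c^{(\alpha,\alpha)}$, numbered by increasing eigenvalues $\chi_0(c)<\chi_1(c)<\cdots$ of $-\mathcal L_c^{(\alpha,\alpha)}$ and normalized by $\int_{-1}^1(\psi_{n,c}^{(\alpha)})^2\omega_\alpha\,dt=1$, and $\mu_n^{(\alpha)}(c)$ is the eigenvalue defined by $\mathcal F_c^{(\alpha)}\psi_{n,c}^{(\alpha)}=\mu_n^{(\alpha)}(c)\psi_{n,c}^{(\alpha)}$. One sets $$\lambda_n^{(\alpha)}(c)=\frac{c}{2\pi}\,|\mu_n^{(\alpha)}(c)|^2 ,$$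 which are the eigenvalues of the positive compact self-adjoint operator $\mathcal Q_c^{\alpha}=\frac{c}{2\pi}\mathcal F_c^{(\alpha)*}\circ\mathcal F_c^{(\alpha)}$ on $L^2(I,\omega_\alpha)$. These eigenvalues are simple, and this numbering is the decreasing one: $\lambda_0^{(\alpha)}(c)>\lambda_1^{(\alpha)}(c)>\cdots$. *)

theory Defs
  imports "HOL-Analysis.Analysis"
begin

(* The value at the endpoints is irrelevant for alpha = 0, where 0 powr 0 = 0: the
   weight is only used under integrals. *)
definition jacobi_weight :: "real \<Rightarrow> real \<Rightarrow> real" where
  "jacobi_weight \<alpha> y = (1 - y\<^sup>2) powr \<alpha>"

definition finite_fourier :: "real \<Rightarrow> real \<Rightarrow> (real \<Rightarrow> complex) \<Rightarrow> real \<Rightarrow> complex" where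
  "finite_fourier \<alpha> c f x =
     (LINT y:{-1..1}|lborel. exp (\<i> * complex_of_real (c * x * y)) * f y
                              * complex_of_real (jacobi_weight \<alpha> y))"

(* Derivative relative to the closed interval, hence one-sided at -1 and 1. *)
definition deriv_I :: "(real \<Rightarrow> real) \<Rightarrow> real \<Rightarrow> real" where
  "deriv_I f x = vector_derivative f (at x within {-1..1})"

definition C2_I :: "(real \<Rightarrow> real) \<Rightarrow> bool" where
  "C2_I f \<longleftrightarrow> f differentiable_on {-1..1} \<and> deriv_I f differentiable_on {-1..1} \<and>
     continuous_on {-1..1} (deriv_I (deriv_I f))"

definition prolate_op :: "real \<Rightarrow> real \<Rightarrow> (real \<Rightarrow> real) \<Rightarrow> real \<Rightarrow> real" where
  "prolate_op \<alpha> c f x =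
     (1 - x\<^sup>2) * deriv_I (deriv_I f) x - (2 * \<alpha> + 2) * x * deriv_I f x - c\<^sup>2 * x\<^sup>2 * f x"

(* Functions are only considered on [-1,1]; their values elsewhere are arbitrary. *)
definition prolate_eigenfunction ::
    "real \<Rightarrow> real \<Rightarrow> real \<Rightarrow> (real \<Rightarrow> real) \<Rightarrow> bool" where
  "prolate_eigenfunction \<alpha> c r f \<longleftrightarrow>
     C2_I f \<and> (\<exists>x\<in>{-1..1}. f x \<noteq> 0) \<and> (\<forall>x\<in>{-1..1}. - prolate_op \<alpha> c f x = r * f x)"

(* The sequence X lists all eigenvalues of the negated operator in increasing order, and
   psi n is a normalized eigenfunction for X n (so it is determined up to sign). *)
definition gpswf_family ::
    "real \<Rightarrow> real \<Rightarrow> (nat \<Rightarrow> real) \<Rightarrow> (nat \<Rightarrow> real \<Rightarrow> real) \<Rightarrow> bool" where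
  "gpswf_family \<alpha> c X \<psi> \<longleftrightarrow>
     strict_mono X \<and>
     range X = {r. \<exists>f. prolate_eigenfunction \<alpha> c r f} \<and>
     (\<forall>n. prolate_eigenfunction \<alpha> c (X n) (\<psi> n)) \<and>
     (\<forall>n. (LINT t:{-1..1}|lborel. (\<psi> n t)\<^sup>2 * jacobi_weight \<alpha> t) = 1)"

definition fourier_eigenvalue :: "real \<Rightarrow> real \<Rightarrow> (real \<Rightarrow> real) \<Rightarrow> complex" where
  "fourier_eigenvalue \<alpha> c f =
     (THE \<mu>. \<forall>x\<in>{-1..1}. finite_fourier \<alpha> c (\<lambda>y. complex_of_real (f y)) x
                             = \<mu> * complex_of_real (f x))"

definition concentration_eigenvalue ::
    "real \<Rightarrow> real \<Rightarrow> (nat \<Rightarrow> real \<Rightarrow> real) \<Rightarrow> nat \<Rightarrow> real" where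
  "concentration_eigenvalue \<alpha> c \<psi> n = c / (2 * pi) * (cmod (fourier_eigenvalue \<alpha> c (\<psi> n)))\<^sup>2"

end

theory Submission
  imports Defs
begin

text \<open>
  Write \<open>\<mu>\<^sub>\<alpha>\<close> and \<open>f\<^sub>\<alpha>\<close> for the Fourier eigenvalue and an eigenfunction of index \<open>n\<close> at exponent \<open>\<alpha>\<close>.
  Since the Fourier kernel is symmetric, Fubini applied to \<open>exp (i c x y) f\<^sub>\<alpha>(y) \<omega>\<^sub>\<alpha>(y) f\<^sub>\<beta>(x) \<omega>\<^sub>\<beta>(x)\<close>
  gives the exact identity \<open>\<mu>\<^sub>\<alpha> \<integral> f\<^sub>\<alpha> f\<^sub>\<beta> \<omega>\<^sub>\<beta> = \<mu>\<^sub>\<beta> \<integral> f\<^sub>\<alpha> f\<^sub>\<beta> \<omega>\<^sub>\<alpha>\<close>. For \<open>\<alpha> > \<beta>\<close> close to each other,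
  \<open>f\<^sub>\<alpha> f\<^sub>\<beta>\<close> is nearly a square while \<open>\<omega>\<^sub>\<alpha> \<le> \<omega>\<^sub>\<beta>\<close>, so the second integral is at most the first and
  \<open>\<bar>\<mu>\<^sub>\<alpha>\<bar> \<le> \<bar>\<mu>\<^sub>\<beta>\<bar>\<close>; local monotonicity propagates to the whole range of exponents. No information on the
  order of the concentration eigenvalues is used, but the \<open>n\<close>-th eigenvalue of the differential operator has to
  exist and to vary continuously with the exponent. It is the only \<open>r\<close> for which the Pruefer angle at \<open>0\<close> of
  the solution regular at \<open>1\<close> is \<open>n \<pi> / 2\<close>: the angle is jointly continuous, strictly increasing in \<open>r\<close>,
  and decreasing along the lines \<open>r + 2 \<alpha> = const\<close>.
\<close>

section \<open>The solution regular at the endpoint\<close>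

text \<open>The equation is singular at both endpoints, and regularity at \<open>1\<close> leaves
  only a one-dimensional space of solutions. As the equation is invariant under reflection,
  \<open>r\<close> is an eigenvalue exactly when its regular solution has vanishing value or
  derivative at \<open>0\<close>; hence the analysis runs on the right half of the interval, and
  multiples of \<pi>/2 rather than of \<pi> count the eigenvalues.

  The delicate step is the comparison of the two integrals. Near the zeros of the eigenfunctions
  their product can be negative, and the gain in weight tends to 0 together with the difference of
  the exponents, so a small defect of positivity proves nothing by itself. It has to be small
  relative to the gain. The gain is largest in relative terms near the endpoints, and there the
  product is positive because eigenfunctions are normalised to have value \<open>1\<close> at
  \<open>1\<close> instead of in L2; this also makes sign and scale continuous in the exponent. The
  Fubini identity is never divided by a Fourier eigenvalue, so the real and imaginary parts of the
  kernel can be treated separately even though parity makes one of the two eigenvalues zero.\<close>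

text \<open>Frobenius coefficients at \<open>x = 1\<close>, in powers of \<open>1 - x\<close>.\<close>

fun jacobi_coeff :: "real \<Rightarrow> real \<Rightarrow> real \<Rightarrow> nat \<Rightarrow> real" where
  "jacobi_coeff c r a 0 = 1"
| "jacobi_coeff c r a (Suc k) =
     ((real k * (real k - 1) + (2 * a + 2) * real k - (r - c\<^sup>2)) * jacobi_coeff c r a k
       - (if k \<ge> 1 then 2 * c\<^sup>2 * jacobi_coeff c r a (k - 1) else 0)
       + (if k \<ge> 2 then c\<^sup>2 * jacobi_coeff c r a (k - 2) else 0))
     / (2 * (real k + 1) * (real k + 1 + a))"

declare jacobi_coeff.simps(2) [simp del]

lemma continuous_on_jacobi_coeff:
  "continuous_on {p. snd p > - 1} (\<lambda>p. jacobi_coeff c (fst p) (snd p) k)"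
proof (induction k rule: less_induct)
  case (less k)
  show ?case
  proof (cases k)
    case 0
    then show ?thesis by simp
  next
    case (Suc m)
    have 1: "continuous_on {p. snd p > - 1} (\<lambda>p. jacobi_coeff c (fst p) (snd p) m)"
      and 2: "continuous_on {p. snd p > - 1} (\<lambda>p. jacobi_coeff c (fst p) (snd p) (m - 1))"
      and 3: "continuous_on {p. snd p > - 1} (\<lambda>p. jacobi_coeff c (fst p) (snd p) (m - 2))"
      by (rule less.IH, simp add: Suc)+
    have "2 * (real m + 1) * (real m + 1 + snd p) \<noteq> 0" if "snd p > - 1" for p :: "real \<times> real"
      using that of_nat_0_le_iff[of m, where 'a = real] by simp
    moreover have "continuous_on {p. snd p > - 1} (\<lambda>p. if m \<ge> 1 then 2 * c\<^sup>2 * jacobi_coeff c (fst p) (snd p) (m - 1) else 0)"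
      by (cases "m \<ge> 1") (auto intro!: continuous_intros 2[unfolded One_nat_def])
    moreover have "continuous_on {p. snd p > - 1} (\<lambda>p. if m \<ge> 2 then c\<^sup>2 * jacobi_coeff c (fst p) (snd p) (m - 2) else 0)"
      by (cases "m \<ge> 2") (auto intro!: continuous_intros 3)
    ultimately show ?thesis
      unfolding Suc jacobi_coeff.simps(2)
      by (intro continuous_intros 1) auto
  qed
qed

section \<open>Geometric decay of the Frobenius coefficients\<close>

text \<open>Growth is tolerated up to index \<open>K\<close>; from then on the ratio 3/4 reproduces
  itself because (3/5)(3/4)^2 + (1/30)(3/4) + 1/30 < (3/4)^3. For small \<open>k\<close> the
  truncated indices \<open>k - 1\<close> and \<open>k - 2\<close> just repeat
  \<open>A 0\<close>.\<close>

lemma three_term_geometric_bound: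
  fixes A :: "nat \<Rightarrow> real"
  assumes A0: "A 0 \<le> 1" and "Q \<ge> 1"
    and crude: "\<And>k. A (Suc k) \<le> Q * A k + Q * A (k - 1) + Q * A (k - 2)"
    and fine: "\<And>k. k \<ge> K \<Longrightarrow> A (Suc k) \<le> (3 / 5) * A k + (1 / 30) * A (k - 1) + (1 / 30) * A (k - 2)"
    and "K \<ge> 2"
  shows "A k \<le> (4 * Q) ^ K * (3 / 4) ^ k"
proof -
  have crude': "A k \<le> (3 * Q) ^ k" for k
  proof (induction k rule: less_induct)
    case (less k)
    show ?case
    proof (cases k)
      case 0
      then show ?thesis using A0 by simp
    next
      case (Suc m)
      have "A j \<le> (3 * Q) ^ m" if "j \<le> m" for j
      proof -
        have "A j \<le> (3 * Q) ^ j" using less.IH[of j] that Suc by simp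
        also have "\<dots> \<le> (3 * Q) ^ m" using that \<open>Q \<ge> 1\<close> by (intro power_increasing) auto
        finally show ?thesis .
      qed
      from this[of m] this[of "m - 1"] this[of "m - 2"]
      have "Q * A m + Q * A (m - 1) + Q * A (m - 2)
          \<le> Q * (3 * Q) ^ m + Q * (3 * Q) ^ m + Q * (3 * Q) ^ m"
        using \<open>Q \<ge> 1\<close> by (intro add_mono mult_left_mono) auto
      with crude[of m] show ?thesis by (simp add: Suc power_mult_distrib algebra_simps)
    qed
  qed
  show ?thesis
  proof (induction k rule: less_induct)
    case (less k)
    show ?case
    proof (cases "k \<le> K")
      case True
      have "A k \<le> (3 * Q) ^ k" by (rule crude')
      \<comment> \<open>Writing 3 as 4 times 3/4 makes the crude bound fit the geometric one; this
        is the origin of the prefactor \<open>(4 * Q) ^ K\<close>.\<close>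
      also have "\<dots> = (4 * Q * (3 / 4)) ^ k" by simp
      also have "\<dots> = (4 * Q) ^ k * (3 / 4) ^ k" by (rule power_mult_distrib)
      also have "\<dots> \<le> (4 * Q) ^ K * (3 / 4) ^ k"
        using True \<open>Q \<ge> 1\<close> by (intro mult_right_mono power_increasing) auto
      finally show ?thesis .
    next
      case False
      then obtain m where k: "k = m + 3" and m: "m + 2 \<ge> K"
        using \<open>K \<ge> 2\<close> by (intro that[of "k - 3"]) auto
      let ?D = "(4 * Q) ^ K"
      have "A k \<le> (3 / 5) * A (m + 2) + (1 / 30) * A (m + 1) + (1 / 30) * A m"
        using fine[of "m + 2"] m by (simp add: k numeral_eq_Suc)
      also have "\<dots> \<le> (3 / 5) * (?D * (3 / 4) ^ (m + 2)) + (1 / 30) * (?D * (3 / 4) ^ (m + 1))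
          + (1 / 30) * (?D * (3 / 4) ^ m)"
        using less.IH[of "m + 2"] less.IH[of "m + 1"] less.IH[of m] k
        by (intro add_mono mult_left_mono) auto
      also have "\<dots> = ?D * (3 / 4) ^ m * ((3 / 5) * (3 / 4)\<^sup>2 + (1 / 30) * (3 / 4) + 1 / 30)"
        by (simp add: field_simps power_add power2_eq_square)
      also have "\<dots> \<le> ?D * (3 / 4) ^ m * (3 / 4) ^ 3"
        using \<open>Q \<ge> 1\<close> by (intro mult_left_mono) (auto simp: power2_eq_square power3_eq_cube)
      also have "\<dots> = ?D * (3 / 4) ^ k" by (simp add: k power_add)
      finally show ?thesis .
    qed
  qed
qed

text \<open>The other singular point lies at distance 2, so the recursion has limiting ratio 1/2;
  3/4 leaves room for the lower-order terms and still reaches beyond \<open>x = 0\<close>.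
  Uniformity in the parameters serves the M-test for joint continuity, and -1/2 provides an open set
  around the exponents \<open>a \<ge> 0\<close> on which \<open>k + 1 + a\<close> stays above
  \<open>k + 1/2\<close>.\<close>

lemma jacobi_coeff_bound:
  assumes R: "R > 0"
  obtains C where "C > 0"
    "\<And>r a k. \<bar>r\<bar> < R \<Longrightarrow> - (1 / 2) < a \<Longrightarrow> a < R \<Longrightarrow> \<bar>jacobi_coeff c r a k\<bar> \<le> C * (3 / 4) ^ k"
proof -
  \<comment> \<open>\<open>M\<close> dominates \<open>\<bar>2 * a + 1\<bar>\<close>,
    \<open>\<bar>r\<bar> + c^2\<close> and \<open>2 * c^2\<close>. The choice of \<open>K\<close>
    gives \<open>M \<le> k / 30\<close> for \<open>k \<ge> K\<close>, which turns the step estimate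
    into the coefficients 3/5, 1/30, 1/30.\<close>
  define M where "M = 2 * R + R + 2 * c\<^sup>2 + 2"
  define K where "K = nat \<lceil>30 * M\<rceil> + 2"
  define Q where "Q = 1 + M"
  have M: "M \<ge> 2" using R by (simp add: M_def)
  have Mc: "2 * c\<^sup>2 \<le> M" "c\<^sup>2 \<le> M"
    using R zero_le_power2[of c] unfolding M_def by linarith+
  have *: "\<bar>jacobi_coeff c r a k\<bar> \<le> (4 * Q) ^ K * (3 / 4) ^ k"
    if r: "\<bar>r\<bar> < R" and a: "- (1 / 2) < a" "a < R" for r a k
  proof (rule three_term_geometric_bound)
    show "Q \<ge> 1" using M by (simp add: Q_def)
    show "K \<ge> 2" by (simp add: K_def)
    have R12: "\<bar>a\<bar> \<le> R + 1/2" using a R by auto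
    have step: "\<bar>jacobi_coeff c r a (Suc k)\<bar> \<le>
        ((real k * real k + M * (real k + 1)) / (2 * (real k + 1) * (real k + 1 / 2))) * \<bar>jacobi_coeff c r a k\<bar>
        + (M / (2 * (real k + 1) * (real k + 1 / 2))) * \<bar>jacobi_coeff c r a (k - 1)\<bar>
        + (M / (2 * (real k + 1) * (real k + 1 / 2))) * \<bar>jacobi_coeff c r a (k - 2)\<bar>" for k
    proof -
      let ?D = "2 * (real k + 1) * (real k + 1 / 2)"
      let ?N = "(real k * (real k - 1) + (2 * a + 2) * real k - (r - c\<^sup>2)) * jacobi_coeff c r a k
       - (if k \<ge> 1 then 2 * c\<^sup>2 * jacobi_coeff c r a (k - 1) else 0)
       + (if k \<ge> 2 then c\<^sup>2 * jacobi_coeff c r a (k - 2) else 0)"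
      have "\<bar>real k * (real k - 1) + (2 * a + 2) * real k - (r - c\<^sup>2)\<bar>
          \<le> real k * real k + \<bar>2 * a + 1\<bar> * real k + \<bar>r\<bar> + c\<^sup>2"
      proof -
        have "real k * (real k - 1) + (2 * a + 2) * real k - (r - c\<^sup>2)
            = real k * real k + (2 * a + 1) * real k - r + c\<^sup>2" by (simp add: algebra_simps)
        also have "\<bar>\<dots>\<bar> \<le> \<bar>real k * real k\<bar> + \<bar>(2 * a + 1) * real k\<bar> + \<bar>r\<bar> + \<bar>c\<^sup>2\<bar>" by linarith
        finally show ?thesis by (simp add: abs_mult)
      qed
      also have "\<dots> \<le> real k * real k + M * real k + M"
      proof -
        have "\<bar>2 * a + 1\<bar> * real k \<le> M * real k"
        proof (rule mult_right_mono)
          have "\<bar>2 * a + 1\<bar> \<le> 2 * \<bar>a\<bar> + 1" by linarith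
          also have "\<dots> \<le> 3 * R + 2 + 0" using R12 R by linarith
          also have "\<dots> \<le> M" unfolding M_def using zero_le_power2[of c] by linarith
          finally show "\<bar>2 * a + 1\<bar> \<le> M" .
        qed simp
        moreover have "\<bar>r\<bar> + c\<^sup>2 \<le> M" unfolding M_def using r R zero_le_power2[of c] by linarith
        ultimately show ?thesis by linarith
      qed
      finally have 1: "\<bar>real k * (real k - 1) + (2 * a + 2) * real k - (r - c\<^sup>2)\<bar>
          \<le> real k * real k + M * (real k + 1)" by (simp add: algebra_simps)
      have "\<bar>?N\<bar> \<le> \<bar>(real k * (real k - 1) + (2 * a + 2) * real k - (r - c\<^sup>2)) * jacobi_coeff c r a k\<bar>
          + \<bar>2 * c\<^sup>2 * jacobi_coeff c r a (k - 1)\<bar> + \<bar>c\<^sup>2 * jacobi_coeff c r a (k - 2)\<bar>"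
      proof -
        have "\<bar>X - (if P then Y else 0) + (if P' then Z else 0)\<bar> \<le> \<bar>X\<bar> + \<bar>Y\<bar> + \<bar>Z\<bar>"
          for X Y Z :: real and P P' by auto
        then show ?thesis .
      qed
      also have "\<dots> \<le> (real k * real k + M * (real k + 1)) * \<bar>jacobi_coeff c r a k\<bar>
          + M * \<bar>jacobi_coeff c r a (k - 1)\<bar> + M * \<bar>jacobi_coeff c r a (k - 2)\<bar>"
        unfolding abs_mult[of _ "jacobi_coeff c r a _"]
        using 1 Mc by (intro add_mono mult_right_mono) auto
      finally have 2: "\<bar>?N\<bar> \<le> \<dots>" .
      have "\<bar>jacobi_coeff c r a (Suc k)\<bar> = \<bar>?N\<bar> / (2 * (real k + 1) * (real k + 1 + a))"
        using a by (simp add: jacobi_coeff.simps(2) abs_mult)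
      also have "\<dots> \<le> \<bar>?N\<bar> / ?D"
        using a by (intro divide_left_mono mult_left_mono mult_pos_pos) auto
      also have "\<dots> \<le> ((real k * real k + M * (real k + 1)) * \<bar>jacobi_coeff c r a k\<bar>
          + M * \<bar>jacobi_coeff c r a (k - 1)\<bar> + M * \<bar>jacobi_coeff c r a (k - 2)\<bar>) / ?D"
        using 2 by (intro divide_right_mono) auto
      also have "\<dots> = ((real k * real k + M * (real k + 1)) / ?D) * \<bar>jacobi_coeff c r a k\<bar>
          + (M / ?D) * \<bar>jacobi_coeff c r a (k - 1)\<bar> + (M / ?D) * \<bar>jacobi_coeff c r a (k - 2)\<bar>"
      proof -
        have "(X * A + Y * B + Y * C) / D = (X / D) * A + (Y / D) * B + (Y / D) * C" for X Y A B C D :: real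
          by (simp add: add_divide_distrib)
        then show ?thesis .
      qed
      finally show ?thesis .
    qed
    show "\<bar>jacobi_coeff c r a (Suc k)\<bar> \<le> Q * \<bar>jacobi_coeff c r a k\<bar>
       + Q * \<bar>jacobi_coeff c r a (k - 1)\<bar> + Q * \<bar>jacobi_coeff c r a (k - 2)\<bar>" for k
    proof (rule order_trans[OF step], intro add_mono mult_right_mono)
      have Dpos: "2 * (real k + 1) * (real k + 1 / 2) > 0" by (intro mult_pos_pos) auto
      have D: "2 * (real k + 1) * (real k + 1 / 2) \<ge> real k + 1"
        by (simp add: algebra_simps)
      have D2: "2 * (real k + 1) * (real k + 1 / 2) \<ge> real k * real k"
        by (simp add: algebra_simps)
      have "real k * real k + M * (real k + 1) \<le> (1 + M) * (2 * (real k + 1) * (real k + 1 / 2))"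
      proof -
        have "real k * real k + M * (real k + 1) \<le> 2 * (real k + 1) * (real k + 1 / 2)
            + M * (2 * (real k + 1) * (real k + 1 / 2))"
          using D D2 M by (intro add_mono mult_left_mono) auto
        also have "\<dots> = (1 + M) * (2 * (real k + 1) * (real k + 1 / 2))"
          by (simp only: distrib_right mult_1_left)
        finally show ?thesis .
      qed
      then show "(real k * real k + M * (real k + 1)) / (2 * (real k + 1) * (real k + 1 / 2)) \<le> Q"
        using Dpos by (simp only: pos_divide_le_eq Q_def)
      have "M * 1 \<le> Q * (2 * (real k + 1) * (real k + 1 / 2))"
        using M D by (intro mult_mono) (auto simp: Q_def)
      then show "M / (2 * (real k + 1) * (real k + 1 / 2)) \<le> Q"
           "M / (2 * (real k + 1) * (real k + 1 / 2)) \<le> Q"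
        using Dpos by (simp_all only: pos_divide_le_eq mult_1_right)
    qed auto
    show "\<bar>jacobi_coeff c r a (Suc k)\<bar> \<le> (3/5) * \<bar>jacobi_coeff c r a k\<bar>
       + (1/30) * \<bar>jacobi_coeff c r a (k - 1)\<bar> + (1/30) * \<bar>jacobi_coeff c r a (k - 2)\<bar>"
      if "k \<ge> K" for k
    proof (rule order_trans[OF step], intro add_mono mult_right_mono)
      have Dpos: "2 * (real k + 1) * (real k + 1 / 2) > 0" by (intro mult_pos_pos) auto
      have k: "real k \<ge> 30 * M" using that by (simp add: K_def) linarith
      have kk: "30 * M * (real k + 1) \<le> real k * (real k + 1)" 
        using k by (intro mult_right_mono) auto
      show "(real k * real k + M * (real k + 1)) / (2 * (real k + 1) * (real k + 1 / 2)) \<le> 3/5"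
      proof -
        have "real k * real k + M * (real k + 1) \<le> (31 / 30) * (real k * real k) + (1 / 30) * real k"
          using kk by (simp add: algebra_simps)
        also have "\<dots> \<le> (6 / 5) * (real k * real k) + (9 / 5) * real k + 3 / 5"
          using zero_le_square[of "real k"] of_nat_0_le_iff[of k, where 'a = real] by linarith
        also have "\<dots> = 3 / 5 * (2 * (real k + 1) * (real k + 1 / 2))" by (simp add: algebra_simps)
        finally show ?thesis unfolding pos_divide_le_eq[OF Dpos] .
      qed
      have "30 * M * 1 \<le> 30 * M * (real k + 1)" using M by (intro mult_left_mono) auto
      then show "M / (2 * (real k + 1) * (real k + 1 / 2)) \<le> 1/30"
           "M / (2 * (real k + 1) * (real k + 1 / 2)) \<le> 1/30"
      proof -
        have "M \<le> (1 / 30) * (real k * real k) + (1 / 30) * real k"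
          using \<open>30 * M * 1 \<le> _\<close> kk by (simp add: algebra_simps)
        also have "\<dots> \<le> (2 / 30) * (real k * real k) + (3 / 30) * real k + 1 / 30"
          using zero_le_square[of "real k"] of_nat_0_le_iff[of k, where 'a = real] by linarith
        also have "\<dots> = 1 / 30 * (2 * (real k + 1) * (real k + 1 / 2))" by (simp add: algebra_simps)
        finally show "M / (2 * (real k + 1) * (real k + 1 / 2)) \<le> 1 / 30"
          unfolding pos_divide_le_eq[OF Dpos] .
        then show "M / (2 * (real k + 1) * (real k + 1 / 2)) \<le> 1 / 30" .
      qed
    qed auto
  qed auto
  show ?thesis
    by (rule that[of "(4 * Q) ^ K"]) (use * M in \<open>auto simp: Q_def\<close>)
qed

section \<open>The power series, its equation and its dependence on the parameters\<close>

definition jacobi_fps :: "real \<Rightarrow> real \<Rightarrow> real \<Rightarrow> real fps" where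
  "jacobi_fps c r a = Abs_fps (jacobi_coeff c r a)"

lemma fps_conv_radius_jacobi_fps:
  assumes "a > - (1 / 2)"
  shows "fps_conv_radius (jacobi_fps c r a) \<ge> 4 / 3"
proof -
  define R where "R = \<bar>r\<bar> + \<bar>a\<bar> + 1"
  have "R > 0" by (simp add: R_def)
  then obtain C where C: "\<And>r a k. \<bar>r\<bar> < R \<Longrightarrow> - (1 / 2) < a \<Longrightarrow> a < R \<Longrightarrow>
      \<bar>jacobi_coeff c r a k\<bar> \<le> C * (3 / 4) ^ k"
    using jacobi_coeff_bound[of R c] by metis
  have *: "\<bar>jacobi_coeff c r a k\<bar> \<le> C * (3 / 4) ^ k" for k
    by (rule C) (use assms in \<open>auto simp: R_def\<close>)
  have "summable (\<lambda>k. jacobi_coeff c r a k * of_real s ^ k)" if s: "0 < s" "ereal s < 4/3" for s :: real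
  proof (rule summable_comparison_test')
    have "s < 4/3" using s by (simp add: divide_ereal_def flip: ereal_divide)
    then show "summable (\<lambda>k. C * (3 / 4 * s) ^ k)"
      using s by (intro summable_mult summable_geometric) auto
    show "norm (jacobi_coeff c r a k * of_real s ^ k) \<le> C * (3 / 4 * s) ^ k" for k
      using mult_right_mono[OF *[of k], of "s ^ k"] s
      by (simp add: abs_mult power_mult_distrib power_divide mult_ac)
  qed
  then show ?thesis
    unfolding fps_conv_radius_def jacobi_fps_def
    by (intro conv_radius_geI_ex') auto
qed

text \<open>In the variable \<open>y = 1 - x\<close> one has \<open>1 - x^2 = y * (2 - y)\<close>
  and d/dx = - d/dy, which turns the eigenvalue equation into this identity; its coefficients are
  the recursion.\<close>

lemma jacobi_fps_ode:
  fixes c r a :: real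
  assumes "a > - (1 / 2)"
  defines "F \<equiv> jacobi_fps c r a"
  shows "fps_X * (2 - fps_X) * fps_deriv (fps_deriv F)
      + fps_const (2 * a + 2) * (1 - fps_X) * fps_deriv F
      + (fps_const r - fps_const (c\<^sup>2) * (1 - fps_X) * (1 - fps_X)) * F = 0"
proof (rule fps_ext)
  fix k :: nat
  have nth: "fps_nth F k = jacobi_coeff c r a k" for k by (simp add: F_def jacobi_fps_def)
  have rec: "2 * (real k + 1) * (real k + 1 + a) * jacobi_coeff c r a (Suc k) =
     ((real k * (real k - 1) + (2 * a + 2) * real k - (r - c\<^sup>2)) * jacobi_coeff c r a k
       - (if k \<ge> 1 then 2 * c\<^sup>2 * jacobi_coeff c r a (k - 1) else 0)
       + (if k \<ge> 2 then c\<^sup>2 * jacobi_coeff c r a (k - 2) else 0))"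
    using assms(1) by (simp add: jacobi_coeff.simps(2))
  have exp: "fps_X * (2 - fps_X) * fps_deriv (fps_deriv F)
      + fps_const (2 * a + 2) * (1 - fps_X) * fps_deriv F
      + (fps_const r - fps_const (c\<^sup>2) * (1 - fps_X) * (1 - fps_X)) * F
     = fps_const 2 * (fps_X * fps_deriv (fps_deriv F)) - fps_X * (fps_X * fps_deriv (fps_deriv F))
       + fps_const (2 * a + 2) * fps_deriv F - fps_const (2 * a + 2) * (fps_X * fps_deriv F)
       + fps_const (r - c\<^sup>2) * F + fps_const (2 * c\<^sup>2) * (fps_X * F) - fps_const (c\<^sup>2) * (fps_X * (fps_X * F))"
  proof -
    have "X * (2 - X) * D2 + P * (1 - X) * D1 + (R - Q * (1 - X) * (1 - X)) * G
        = 2 * (X * D2) - X * (X * D2) + P * D1 - P * (X * D1) + (R - Q) * G + (2 * Q) * (X * G) - Q * (X * (X * G))"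
      for X D2 P D1 R Q G :: "real fps"
      by (simp add: algebra_simps)
    note gen = this
    have eqs: "fps_const (r - c\<^sup>2) = fps_const r - fps_const (c\<^sup>2)"
        "fps_const (2 * c\<^sup>2) = 2 * fps_const (c\<^sup>2)" "fps_const 2 = (2 :: real fps)"
      by (simp_all add: numeral_fps_const)
    show ?thesis unfolding eqs by (rule gen)
  qed
  \<comment> \<open>Shifting by \<open>fps_X\<close> once or twice kills the coefficients below
    index 1 or 2; these are the guards in the recursion.\<close>
  consider "k = 0" | "k = 1" | m where "k = Suc (Suc m)"
    by (metis One_nat_def not0_implies_Suc)
  then show "fps_nth (fps_X * (2 - fps_X) * fps_deriv (fps_deriv F)
      + fps_const (2 * a + 2) * (1 - fps_X) * fps_deriv F
      + (fps_const r - fps_const (c\<^sup>2) * (1 - fps_X) * (1 - fps_X)) * F) k = fps_nth 0 k"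
  proof cases
    case 1
    then show ?thesis unfolding exp using rec
      by (simp add: nth) (simp add: algebra_simps)
  next
    case 2
    then show ?thesis unfolding exp using rec
      by (simp add: nth) (simp add: algebra_simps)
  next
    case (3 m)
    have [simp]: "Suc (Suc m) - 2 = m" by simp
    show ?thesis unfolding exp using rec unfolding 3
      by (simp add: nth del: of_nat_Suc) (simp add: algebra_simps)
  qed
qed

text \<open>The derivative is explicit because it enters the Wronskian and the data at
  \<open>0\<close>. Keeping the factor \<open>1 - x^2\<close> gives the equation a meaning at the
  endpoints, and derivatives relative to \<open>S\<close> match \<open>C2_I\<close>.\<close>

definition prolate_ode ::
    "real \<Rightarrow> real \<Rightarrow> real \<Rightarrow> real set \<Rightarrow> (real \<Rightarrow> real) \<Rightarrow> (real \<Rightarrow> real) \<Rightarrow> bool" where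
  "prolate_ode c a r S f f' \<longleftrightarrow> (\<exists>f''. continuous_on S f'' \<and> (\<forall>x\<in>S.
     (f has_real_derivative f' x) (at x within S) \<and> (f' has_real_derivative f'' x) (at x within S) \<and>
     (1 - x\<^sup>2) * f'' x = (2 * a + 2) * x * f' x + (c\<^sup>2 * x\<^sup>2 - r) * f x))"

definition radial :: "real \<Rightarrow> real \<Rightarrow> real \<Rightarrow> real \<Rightarrow> real" where
  "radial c r a x = eval_fps (jacobi_fps c r a) (1 - x)"

definition radial' :: "real \<Rightarrow> real \<Rightarrow> real \<Rightarrow> real \<Rightarrow> real" where
  "radial' c r a x = - eval_fps (fps_deriv (jacobi_fps c r a)) (1 - x)"

lemma radial_1 [simp]: "radial c r a 1 = 1"
  by (simp add: radial_def eval_fps_at_0 jacobi_fps_def)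

text \<open>Here \<open>\<bar>1 - x\<bar> \<le> 5/4\<close>, inside the disc of radius 4/3. Reaching
  past \<open>0\<close> matters: the overlap with the mirror image makes the even or odd extension
  smooth at \<open>0\<close>.\<close>

lemma prolate_ode_radial:
  assumes a: "a > - (1 / 2)"
  shows "prolate_ode c a r {- (1 / 4)..1} (radial c r a) (radial' c r a)"
  unfolding prolate_ode_def
proof (intro exI conjI ballI)
  let ?F = "jacobi_fps c r a"
  let ?F1 = "fps_deriv ?F"
  let ?F2 = "fps_deriv ?F1"
  have r0: "fps_conv_radius ?F \<ge> 4 / 3" by (rule fps_conv_radius_jacobi_fps[OF a])
  have r1: "fps_conv_radius ?F1 \<ge> 4 / 3" using fps_conv_radius_deriv[of ?F] r0 by (rule order_trans[rotated])
  have r2: "fps_conv_radius ?F2 \<ge> 4 / 3" using fps_conv_radius_deriv[of ?F1] r1 by (rule order_trans[rotated])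
  have lt: "ereal (norm (1 - x)) < 4 / 3" if "x \<in> {- (1 / 4)..1}" for x :: real
  proof -
    have "\<bar>1 - x\<bar> < 4 / 3" using that by auto
    then show ?thesis by (simp add: divide_ereal_def flip: ereal_divide)
  qed
  note lt0 = less_le_trans[OF lt r0] and lt1 = less_le_trans[OF lt r1] and lt2 = less_le_trans[OF lt r2]
  have sub: "1 - x \<in> eball 0 (fps_conv_radius ?F2)" if "x \<in> {- (1 / 4)..1}" for x :: real
    using lt2[OF that] by (simp only: in_eball_iff dist_0_norm)
  show "continuous_on {- (1 / 4)..1} (\<lambda>x. eval_fps ?F2 (1 - x))"
    by (intro continuous_on_eval_fps' continuous_intros image_subsetI sub)
  have chain: "((\<lambda>x. eval_fps G (1 - x)) has_real_derivative - eval_fps (fps_deriv G) (1 - x)) (at x within S)"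
    if "ereal (norm (1 - x)) < fps_conv_radius G" for G x S
  proof -
    have "((\<lambda>x :: real. 1 - x) has_real_derivative - 1) (at x within S)"
      by (auto intro!: derivative_eq_intros)
    from DERIV_chain2[OF has_field_derivative_eval_fps[OF that] this] show ?thesis by simp
  qed
  fix x :: real
  assume x: "x \<in> {- (1 / 4)..1}"
  show "(radial c r a has_real_derivative radial' c r a x) (at x within {- (1 / 4)..1})"
    unfolding radial_def[abs_def] radial'_def
    by (rule chain[OF lt0[OF x]])
  show "(radial' c r a has_real_derivative eval_fps ?F2 (1 - x)) (at x within {- (1 / 4)..1})"
    unfolding radial'_def[abs_def]
    using DERIV_minus[OF chain[OF lt1[OF x]]] by simp
  have "(fps_X * (2 - fps_X) * ?F2 + fps_const (2 * a + 2) * (1 - fps_X) * ?F1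
      + (fps_const r - fps_const (c\<^sup>2) * (1 - fps_X) * (1 - fps_X)) * ?F) = 0"
    by (rule jacobi_fps_ode[OF a])
  moreover have "eval_fps (fps_X * (2 - fps_X) * ?F2 + fps_const (2 * a + 2) * (1 - fps_X) * ?F1
      + (fps_const r - fps_const (c\<^sup>2) * (1 - fps_X) * (1 - fps_X)) * ?F) (1 - x)
     = (1 - x) * (2 - (1 - x)) * eval_fps ?F2 (1 - x) + (2 * a + 2) * (1 - (1 - x)) * eval_fps ?F1 (1 - x)
      + (r - c\<^sup>2 * (1 - (1 - x)) * (1 - (1 - x))) * eval_fps ?F (1 - x)"
  proof -
    let ?y = "1 - x"
    \<comment> \<open>\<open>eval_fps\<close> respects sums and products only inside the discs of
      convergence, so every building block carries its radius condition along with its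
      value.\<close>
    let ?OK = "\<lambda>G v. ereal (norm ?y) < fps_conv_radius G \<and> eval_fps G ?y = v"
    have plus: "?OK (G + H) (v + w)" if "?OK G v" "?OK H w" for G H :: "real fps" and v w
      using that by (auto simp: eval_fps_add intro!: less_le_trans[OF _ fps_conv_radius_add])
    have minus: "?OK (G - H) (v - w)" if "?OK G v" "?OK H w" for G H :: "real fps" and v w
      using that by (auto simp: eval_fps_diff intro!: less_le_trans[OF _ fps_conv_radius_diff])
    have times: "?OK (G * H) (v * w)" if "?OK G v" "?OK H w" for G H :: "real fps" and v w
      using that by (auto simp: eval_fps_mult intro!: less_le_trans[OF _ fps_conv_radius_mult])
    have "?OK (fps_X * (2 - fps_X) * ?F2 + fps_const (2 * a + 2) * (1 - fps_X) * ?F1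
      + (fps_const r - fps_const (c\<^sup>2) * (1 - fps_X) * (1 - fps_X)) * ?F)
      (?y * (2 - ?y) * eval_fps ?F2 ?y + (2 * a + 2) * (1 - ?y) * eval_fps ?F1 ?y
      + (r - c\<^sup>2 * (1 - ?y) * (1 - ?y)) * eval_fps ?F ?y)"
      by (intro plus minus times) (use lt0[OF x] lt1[OF x] lt2[OF x] in auto)
    then show ?thesis by blast
  qed
  ultimately have "(1 - x\<^sup>2) * eval_fps ?F2 (1 - x) + (2 * a + 2) * x * eval_fps ?F1 (1 - x)
      + (r - c\<^sup>2 * x\<^sup>2) * eval_fps ?F (1 - x) = 0"
    by (simp add: power2_eq_square algebra_simps)
  then show "(1 - x\<^sup>2) * eval_fps ?F2 (1 - x)
      = (2 * a + 2) * x * radial' c r a x + (c\<^sup>2 * x\<^sup>2 - r) * radial c r a x"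
    by (simp add: radial_def radial'_def algebra_simps)
qed

text \<open>On each piece with bounded parameters the series is dominated by a geometric one of
  ratio 15/16 = (3/4)(5/4), and the derivative by the differentiated geometric series. The pieces
  are open, so continuity passes to their union.\<close>

lemma continuous_on_radial:
  "continuous_on {p. \<bar>1 - fst p\<bar> < 5 / 4 \<and> snd (snd p) > - (1 / 2)}
     (\<lambda>p. radial c (fst (snd p)) (snd (snd p)) (fst p))" (is "continuous_on ?S ?u")
  and continuous_on_radial':
  "continuous_on {p. \<bar>1 - fst p\<bar> < 5 / 4 \<and> snd (snd p) > - (1 / 2)}
     (\<lambda>p. radial' c (fst (snd p)) (snd (snd p)) (fst p))" (is "continuous_on ?S ?v")
proof -
  define B where "B R = {p :: real \<times> real \<times> real. \<bar>1 - fst p\<bar> < 5 / 4 \<and> \<bar>fst (snd p)\<bar> < R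
      \<and> snd (snd p) > - (1 / 2) \<and> snd (snd p) < R}" for R
  have openB: "open (B R)" for R
    unfolding B_def by (intro open_Collect_conj open_Collect_less continuous_intros)
  have S: "?S = (\<Union>R\<in>{0<..}. B R)"
  proof (intro set_eqI iffI)
    fix p :: "real \<times> real \<times> real"
    assume "p \<in> ?S"
    then have "p \<in> B (\<bar>fst (snd p)\<bar> + \<bar>snd (snd p)\<bar> + 1)" by (auto simp: B_def)
    then show "p \<in> (\<Union>R\<in>{0<..}. B R)" by (rule UN_I[rotated]) auto
  qed (auto simp: B_def)
  have "continuous_on (B R) ?u \<and> continuous_on (B R) ?v" if R: "R > 0" for R
  proof -
    obtain C where C: "C > 0" "\<And>r a k. \<bar>r\<bar> < R \<Longrightarrow> - (1 / 2) < a \<Longrightarrow> a < R \<Longrightarrow>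
        \<bar>jacobi_coeff c r a k\<bar> \<le> C * (3 / 4) ^ k"
      using jacobi_coeff_bound[OF R, of c] by metis
    have cc: "continuous_on (B R) (\<lambda>p. jacobi_coeff c (fst (snd p)) (snd (snd p)) k)" for k
      by (rule continuous_on_compose2[OF continuous_on_jacobi_coeff, of _ snd])
         (auto simp: B_def intro!: continuous_intros)
    have bnd: "norm (jacobi_coeff c (fst (snd p)) (snd (snd p)) j * (1 - fst p) ^ k)
        \<le> C * (3 / 4) ^ j * (5 / 4) ^ k" if "p \<in> B R" for p j k
      unfolding real_norm_def abs_mult power_abs
      using that C by (intro mult_mono power_mono) (auto simp: B_def)
    have "uniform_limit (B R)
       (\<lambda>n p. \<Sum>k<n. jacobi_coeff c (fst (snd p)) (snd (snd p)) k * (1 - fst p) ^ k) ?u sequentially"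
      unfolding radial_def jacobi_fps_def eval_fps_def fps_nth_Abs_fps
    proof (rule Weierstrass_m_test)
      show "norm (jacobi_coeff c (fst (snd p)) (snd (snd p)) k * (1 - fst p) ^ k) \<le> C * (15 / 16) ^ k"
        if "p \<in> B R" for k p
        using bnd[OF that, of k k] by (simp add: mult.assoc flip: power_mult_distrib)
      show "summable (\<lambda>k. C * (15 / 16 :: real) ^ k)"
        by (intro summable_mult summable_geometric) auto
    qed
    then have u: "continuous_on (B R) ?u"
      by (rule uniform_limit_theorem[rotated])
         (auto intro!: always_eventually continuous_intros cc)
    have "uniform_limit (B R)
       (\<lambda>n p. \<Sum>k<n. real (Suc k) * jacobi_coeff c (fst (snd p)) (snd (snd p)) (Suc k) * (1 - fst p) ^ k)
       (\<lambda>p. - ?v p) sequentially"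
      unfolding radial'_def jacobi_fps_def eval_fps_def fps_nth_Abs_fps fps_deriv_nth minus_minus Suc_eq_plus1
    proof (rule Weierstrass_m_test)
      show "norm (real (k + 1) * jacobi_coeff c (fst (snd p)) (snd (snd p)) (k + 1) * (1 - fst p) ^ k)
          \<le> C * (real (Suc k) * (15 / 16) ^ k)"
        if "p \<in> B R" for k p
      proof -
        have "norm (real (k + 1) * jacobi_coeff c (fst (snd p)) (snd (snd p)) (k + 1) * (1 - fst p) ^ k)
           = real (k + 1) * norm (jacobi_coeff c (fst (snd p)) (snd (snd p)) (k + 1) * (1 - fst p) ^ k)"
          by (simp add: norm_mult abs_mult)
        also have "\<dots> \<le> real (k + 1) * (C * (3 / 4) ^ (k + 1) * (5 / 4) ^ k)"
          by (intro mult_left_mono bnd that) auto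
        also have "\<dots> \<le> real (k + 1) * (C * (3 / 4) ^ k * (5 / 4) ^ k)"
          using C(1) by (intro mult_left_mono mult_right_mono) (auto simp: power_add)
        also have "\<dots> = C * (real (Suc k) * (15 / 16) ^ k)"
          by (simp add: mult_ac flip: power_mult_distrib)
        finally show ?thesis .
      qed
      show "summable (\<lambda>k. C * (real (Suc k) * (15 / 16 :: real) ^ k))"
        by (intro summable_mult sums_summable[OF geometric_deriv_sums]) auto
    qed
    then have "continuous_on (B R) (\<lambda>p. - ?v p)"
      by (rule uniform_limit_theorem[rotated])
         (auto intro!: always_eventually continuous_intros cc)
    then have v: "continuous_on (B R) ?v"
      by (rule continuous_on_minus[where f = "\<lambda>p. - ?v p", simplified])
    show ?thesis using u v by blast
  qed
  then show "continuous_on ?S ?u" "continuous_on ?S ?v"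
    unfolding S by (intro continuous_on_open_UN openB; simp)+
qed

section \<open>Uniqueness and the Wronskian\<close>

text \<open>Gronwall's argument: \<open>E = g^2 + h^2\<close> satisfies
  \<open>\<bar>E'\<bar> \<le> L * E\<close>, so \<open>E * exp (- L * x)\<close> decreases and
  \<open>E * exp (L * x)\<close> increases; the first settles the points right of \<open>x0\<close>,
  the second those left of it.\<close>

lemma linear_ode_zero:
  fixes g h k :: "real \<Rightarrow> real"
  assumes g: "\<And>x. x \<in> {A..B} \<Longrightarrow> (g has_real_derivative h x) (at x within {A..B})"
    and h: "\<And>x. x \<in> {A..B} \<Longrightarrow> (h has_real_derivative k x) (at x within {A..B})"
    and k: "\<And>x. x \<in> {A..B} \<Longrightarrow> \<bar>k x\<bar> \<le> K * \<bar>g x\<bar> + K * \<bar>h x\<bar>"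
    and x0: "x0 \<in> {A..B}" "g x0 = 0" "h x0 = 0" and x: "x \<in> {A..B}"
  shows "g x = 0 \<and> h x = 0"
proof -
  define E where "E y = (g y)\<^sup>2 + (h y)\<^sup>2" for y
  define E' where "E' y = 2 * g y * h y + 2 * h y * k y" for y
  define L where "L = 1 + 3 * \<bar>K\<bar>"
  have E: "(E has_real_derivative E' y) (at y within {A..B})" if "y \<in> {A..B}" for y
    unfolding E_def[abs_def] E'_def
    by (auto intro!: derivative_eq_intros g h that simp: algebra_simps)
  have bnd: "\<bar>E' y\<bar> \<le> L * E y" if "y \<in> {A..B}" for y
  proof -
    have gh: "2 * (\<bar>g y\<bar> * \<bar>h y\<bar>) \<le> E y"
      using sum_squares_bound[of "\<bar>g y\<bar>" "\<bar>h y\<bar>"] by (simp add: E_def)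
    have hh: "\<bar>h y\<bar> * \<bar>h y\<bar> \<le> E y" by (simp add: E_def power2_eq_square)
    have "\<bar>E' y\<bar> \<le> 2 * (\<bar>g y\<bar> * \<bar>h y\<bar>) + 2 * (\<bar>h y\<bar> * \<bar>k y\<bar>)"
      unfolding E'_def by (rule order_trans[OF abs_triangle_ineq]) (simp add: abs_mult)
    also have "\<bar>h y\<bar> * \<bar>k y\<bar> \<le> \<bar>h y\<bar> * (\<bar>K\<bar> * \<bar>g y\<bar> + \<bar>K\<bar> * \<bar>h y\<bar>)"
      by (intro mult_left_mono order_trans[OF k[OF that]] add_mono mult_right_mono) auto
    also have "\<dots> = \<bar>K\<bar> * (\<bar>g y\<bar> * \<bar>h y\<bar>) + \<bar>K\<bar> * (\<bar>h y\<bar> * \<bar>h y\<bar>)"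
      by (simp add: algebra_simps)
    finally have "\<bar>E' y\<bar> \<le> 2 * (\<bar>g y\<bar> * \<bar>h y\<bar>) + \<bar>K\<bar> * (2 * (\<bar>g y\<bar> * \<bar>h y\<bar>)) + 2 * (\<bar>K\<bar> * (\<bar>h y\<bar> * \<bar>h y\<bar>))"
      by simp
    also have "\<dots> \<le> E y + \<bar>K\<bar> * E y + 2 * (\<bar>K\<bar> * E y)"
      using gh hh by (intro add_mono mult_left_mono) auto
    finally show ?thesis by (simp add: L_def algebra_simps)
  qed
  have E0: "E x0 = 0" using x0 by (simp add: E_def)
  have "E x \<le> 0"
  proof (cases "x0 \<le> x")
    case True
    have "E x * exp (- L * x) \<le> E x0 * exp (- L * x0)"
    proof (rule DERIV_nonpos_imp_decreasing_open[OF True])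
      fix y assume y: "x0 < y" "y < x"
      then have "y \<in> {A<..<B}" using x x0 by auto
      then have "(E has_real_derivative E' y) (at y)"
        using E[of y] at_within_Icc_at[of A y B] by auto
      then have "((\<lambda>y. E y * exp (- L * y)) has_real_derivative (E' y - L * E y) * exp (- L * y)) (at y)"
        by (auto intro!: derivative_eq_intros simp: algebra_simps)
      moreover have "(E' y - L * E y) * exp (- L * y) \<le> 0"
        using bnd[of y] y x x0 by (intro mult_nonpos_nonneg) auto
      ultimately show "\<exists>d. ((\<lambda>y. E y * exp (- L * y)) has_real_derivative d) (at y) \<and> d \<le> 0" by blast
    next
      have "continuous_on {A..B} E" using E by (rule DERIV_continuous_on)
      then show "continuous_on {x0..x} (\<lambda>y. E y * exp (- L * y))"
        using x x0 by (intro continuous_intros) (auto intro: continuous_on_subset)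
    qed
    then show ?thesis by (simp add: E0 mult_le_0_iff)
  next
    case False
    then have le: "x \<le> x0" by simp
    have "E x * exp (L * x) \<le> E x0 * exp (L * x0)"
    proof (rule DERIV_nonneg_imp_increasing_open[OF le])
      fix y assume y: "x < y" "y < x0"
      then have "y \<in> {A<..<B}" using x x0 by auto
      then have "(E has_real_derivative E' y) (at y)"
        using E[of y] at_within_Icc_at[of A y B] by auto
      then have "((\<lambda>y. E y * exp (L * y)) has_real_derivative (E' y + L * E y) * exp (L * y)) (at y)"
        by (auto intro!: derivative_eq_intros simp: algebra_simps)
      moreover have "(E' y + L * E y) * exp (L * y) \<ge> 0"
        using bnd[of y] y x x0 by (intro mult_nonneg_nonneg) auto
      ultimately show "\<exists>d. ((\<lambda>y. E y * exp (L * y)) has_real_derivative d) (at y) \<and> d \<ge> 0" by blast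
    next
      have "continuous_on {A..B} E" using E by (rule DERIV_continuous_on)
      then show "continuous_on {x..x0} (\<lambda>y. E y * exp (L * y))"
        using x x0 by (intro continuous_intros) (auto intro: continuous_on_subset)
    qed
    then show ?thesis by (simp add: E0 mult_le_0_iff)
  qed
  then show ?thesis unfolding E_def
    by (metis add_nonneg_eq_0_iff antisym power2_eq_iff_nonneg sum_power2_ge_zero sum_power2_le_zero_iff)
qed

text \<open>Agrees with \<^const>\<open>jacobi_weight\<close> inside the interval, but is also continuous at the endpoints
  for exponent \<open>0\<close>.\<close>
definition gweight :: "real \<Rightarrow> real \<Rightarrow> real" where
  "gweight a x = (if a = 0 then 1 else (1 - x\<^sup>2) powr a)"

lemma square_lt_1: "x\<^sup>2 < 1" if "- 1 < x" "x < 1" for x :: real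
  using that by (simp add: abs_square_less_1)

lemma square_le_1: "x\<^sup>2 \<le> 1" if "- 1 \<le> x" "x \<le> 1" for x :: real
  using that by (simp add: abs_square_le_1)

lemma gweight_0 [simp]: "gweight a 0 = 1"
  by (simp add: gweight_def)

lemma gweight_eq_jacobi_weight: "- 1 < x \<Longrightarrow> x < 1 \<Longrightarrow> gweight a x = jacobi_weight a x"
  using square_lt_1[of x] by (auto simp: gweight_def jacobi_weight_def)

lemma gweight_nonneg [simp]: "gweight a x \<ge> 0"
  by (simp add: gweight_def)

lemma gweight_pos: "- 1 < x \<Longrightarrow> x < 1 \<Longrightarrow> gweight a x > 0"
  using square_lt_1[of x] by (auto simp: gweight_def)

lemma gweight_le_1: "a \<ge> 0 \<Longrightarrow> - 1 \<le> x \<Longrightarrow> x \<le> 1 \<Longrightarrow> gweight a x \<le> 1"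
  using square_le_1[of x] by (auto simp: gweight_def intro: powr_le1)

lemma continuous_on_gweight: "a \<ge> 0 \<Longrightarrow> continuous_on {-1..1} (gweight a)"
  unfolding gweight_def
  by (cases "a = 0") (auto intro!: continuous_intros continuous_on_powr' simp: square_le_1)

text \<open>The function is the leading coefficient in the Sturm-Liouville form of the operator,
  whose derivative has to reproduce the first-order term times the weight.\<close>

lemma gweight_flux_deriv:
  assumes "- 1 < x" "x < 1"
  shows "((\<lambda>x. (1 - x\<^sup>2) * gweight a x) has_real_derivative - (2 * a + 2) * x * gweight a x) (at x)"
proof -
  have pos: "1 - x\<^sup>2 > 0" using square_lt_1[OF assms] by simp
  have "((\<lambda>x. (1 - x\<^sup>2) * (1 - x\<^sup>2) powr a) has_real_derivative
      - 2 * x * (1 - x\<^sup>2) powr a + (1 - x\<^sup>2) * (a * (1 - x\<^sup>2) powr (a - 1) * (- 2 * x))) (at x)"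
    using pos by (auto intro!: derivative_eq_intros)
  moreover have "(1 - x\<^sup>2) * (1 - x\<^sup>2) powr (a - 1) = (1 - x\<^sup>2) powr a"
    using pos by (simp add: powr_diff)
  then have "(1 - x\<^sup>2) * (a * (1 - x\<^sup>2) powr (a - 1) * (- 2 * x)) = a * (1 - x\<^sup>2) powr a * (- 2 * x)"
    by (metis mult.assoc mult.left_commute)
  ultimately have "((\<lambda>x. (1 - x\<^sup>2) * (1 - x\<^sup>2) powr a) has_real_derivative
      - (2 * a + 2) * x * (1 - x\<^sup>2) powr a) (at x)"
    by (auto elim!: DERIV_cong simp: algebra_simps)
  then show ?thesis
    by (cases "a = 0") (auto simp: gweight_def intro!: derivative_eq_intros)
qed

section \<open>Linear structure, reflection and uniqueness of solutions\<close>

lemma prolate_odeE: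
  assumes "prolate_ode c a r S f f'"
  obtains f'' where "continuous_on S f''"
     "\<And>x. x \<in> S \<Longrightarrow> (f has_real_derivative f' x) (at x within S)"
     "\<And>x. x \<in> S \<Longrightarrow> (f' has_real_derivative f'' x) (at x within S)"
     "\<And>x. x \<in> S \<Longrightarrow> (1 - x\<^sup>2) * f'' x = (2 * a + 2) * x * f' x + (c\<^sup>2 * x\<^sup>2 - r) * f x"
  using assms unfolding prolate_ode_def by blast

lemma prolate_ode_continuous:
  assumes "prolate_ode c a r S f f'"
  shows "continuous_on S f" "continuous_on S f'"
  by (rule prolate_odeE[OF assms], erule DERIV_continuous_on)+

lemma prolate_ode_subset:
  "prolate_ode c a r S f f' \<Longrightarrow> T \<subseteq> S \<Longrightarrow> prolate_ode c a r T f f'"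
  unfolding prolate_ode_def
  by (blast intro: continuous_on_subset has_field_derivative_subset)

lemma prolate_ode_lincomb:
  assumes "prolate_ode c a r S f f'" "prolate_ode c a r S g g'"
  shows "prolate_ode c a r S (\<lambda>x. s * f x + t * g x) (\<lambda>x. s * f' x + t * g' x)"
proof -
  obtain f'' where f: "continuous_on S f''"
     "\<And>x. x \<in> S \<Longrightarrow> (f has_real_derivative f' x) (at x within S)"
     "\<And>x. x \<in> S \<Longrightarrow> (f' has_real_derivative f'' x) (at x within S)"
     "\<And>x. x \<in> S \<Longrightarrow> (1 - x\<^sup>2) * f'' x = (2 * a + 2) * x * f' x + (c\<^sup>2 * x\<^sup>2 - r) * f x"
    by (rule prolate_odeE[OF assms(1)], rule that)
  obtain g'' where g: "continuous_on S g''"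
     "\<And>x. x \<in> S \<Longrightarrow> (g has_real_derivative g' x) (at x within S)"
     "\<And>x. x \<in> S \<Longrightarrow> (g' has_real_derivative g'' x) (at x within S)"
     "\<And>x. x \<in> S \<Longrightarrow> (1 - x\<^sup>2) * g'' x = (2 * a + 2) * x * g' x + (c\<^sup>2 * x\<^sup>2 - r) * g x"
    by (rule prolate_odeE[OF assms(2)], rule that)
  show ?thesis
    unfolding prolate_ode_def
  proof (intro exI[of _ "\<lambda>x. s * f'' x + t * g'' x"] conjI ballI)
    show "continuous_on S (\<lambda>x. s * f'' x + t * g'' x)" by (intro continuous_intros f g)
    fix x assume x: "x \<in> S"
    show "((\<lambda>x. s * f x + t * g x) has_real_derivative s * f' x + t * g' x) (at x within S)"
      by (intro DERIV_add DERIV_cmult f g x)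
    show "((\<lambda>x. s * f' x + t * g' x) has_real_derivative s * f'' x + t * g'' x) (at x within S)"
      by (intro DERIV_add DERIV_cmult f g x)
    have "(1 - x\<^sup>2) * (s * f'' x + t * g'' x) = s * ((1 - x\<^sup>2) * f'' x) + t * ((1 - x\<^sup>2) * g'' x)"
      by (simp add: algebra_simps)
    also have "\<dots> = (2 * a + 2) * x * (s * f' x + t * g' x) + (c\<^sup>2 * x\<^sup>2 - r) * (s * f x + t * g x)"
      unfolding f(4)[OF x] g(4)[OF x] by (simp add: algebra_simps)
    finally show "(1 - x\<^sup>2) * (s * f'' x + t * g'' x)
        = (2 * a + 2) * x * (s * f' x + t * g' x) + (c\<^sup>2 * x\<^sup>2 - r) * (s * f x + t * g x)" .
  qed
qed

lemma prolate_ode_reflect: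
  assumes "prolate_ode c a r {-s..s} f f'"
  shows "prolate_ode c a r {-s..s} (\<lambda>x. f (- x)) (\<lambda>x. - f' (- x))"
proof -
  obtain f'' where f: "continuous_on {-s..s} f''"
     "\<And>x. x \<in> {-s..s} \<Longrightarrow> (f has_real_derivative f' x) (at x within {-s..s})"
     "\<And>x. x \<in> {-s..s} \<Longrightarrow> (f' has_real_derivative f'' x) (at x within {-s..s})"
     "\<And>x. x \<in> {-s..s} \<Longrightarrow> (1 - x\<^sup>2) * f'' x = (2 * a + 2) * x * f' x + (c\<^sup>2 * x\<^sup>2 - r) * f x"
    by (rule prolate_odeE[OF assms], rule that)
  have img: "uminus ` {-s..s} = {-s..s}" by simp
  have refl: "((\<lambda>x. g (- x)) has_real_derivative - d) (at x within {-s..s})"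
    if "(g has_real_derivative d) (at (- x) within {-s..s})" for g :: "real \<Rightarrow> real" and d x
  proof -
    have "(uminus has_real_derivative - 1) (at x within {-s..s})"
      by (auto intro!: derivative_eq_intros)
    moreover have "(g has_real_derivative d) (at (- x) within uminus ` {-s..s})"
      using that by (simp only: img)
    ultimately have "((g \<circ> uminus) has_real_derivative d * - 1) (at x within {-s..s})"
      by (intro DERIV_image_chain)
    then show ?thesis by (simp add: o_def)
  qed
  show ?thesis
    unfolding prolate_ode_def
  proof (intro exI[of _ "\<lambda>x. f'' (- x)"] conjI ballI)
    show "continuous_on {-s..s} (\<lambda>x. f'' (- x))"
      by (rule continuous_on_compose2[OF f(1)]) (auto intro!: continuous_intros)
    fix x assume "x \<in> {-s..s}"
    then have x: "- x \<in> {-s..s}" by auto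
    show "((\<lambda>x. f (- x)) has_real_derivative - f' (- x)) (at x within {-s..s})"
      by (rule refl[OF f(2)[OF x]])
    show "((\<lambda>x. - f' (- x)) has_real_derivative f'' (- x)) (at x within {-s..s})"
      using DERIV_minus[OF refl[OF f(3)[OF x]]] by simp
    show "(1 - x\<^sup>2) * f'' (- x) = (2 * a + 2) * x * - f' (- x) + (c\<^sup>2 * x\<^sup>2 - r) * f (- x)"
      using f(4)[OF x] by simp
  qed
qed

text \<open>Away from the endpoints \<open>1 - x^2\<close> is bounded below by
  \<open>1 - m^2 > 0\<close>, so the equation can be solved for the second derivative with bounded
  coefficients.\<close>

lemma prolate_ode_unique:
  assumes ode: "prolate_ode c a r {A..B} f f'" and AB: "- 1 < A" "B < 1"
    and x0: "x0 \<in> {A..B}" "f x0 = 0" "f' x0 = 0" and x: "x \<in> {A..B}"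
  shows "f x = 0 \<and> f' x = 0"
proof -
  obtain f'' where f: "continuous_on {A..B} f''"
     "\<And>x. x \<in> {A..B} \<Longrightarrow> (f has_real_derivative f' x) (at x within {A..B})"
     "\<And>x. x \<in> {A..B} \<Longrightarrow> (f' has_real_derivative f'' x) (at x within {A..B})"
     "\<And>x. x \<in> {A..B} \<Longrightarrow> (1 - x\<^sup>2) * f'' x = (2 * a + 2) * x * f' x + (c\<^sup>2 * x\<^sup>2 - r) * f x"
    by (rule prolate_odeE[OF ode], rule that)
  define m where "m = max \<bar>A\<bar> \<bar>B\<bar>"
  define L where "L = \<bar>2 * a + 2\<bar> + c\<^sup>2 + \<bar>r\<bar>"
  have m: "m < 1" "m \<ge> 0" using AB x by (auto simp: m_def)
  have m2: "m\<^sup>2 < 1" using m by (simp add: abs_square_less_1)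
  have "\<bar>f'' y\<bar> \<le> (L / (1 - m\<^sup>2)) * \<bar>f y\<bar> + (L / (1 - m\<^sup>2)) * \<bar>f' y\<bar>" if y: "y \<in> {A..B}" for y
  proof -
    have ym: "\<bar>y\<bar> \<le> m" using y by (auto simp: m_def)
    have y2: "y\<^sup>2 \<le> m\<^sup>2" using ym m by (simp add: abs_le_square_iff[symmetric])
    have y1: "\<bar>y\<bar> \<le> 1" "y\<^sup>2 \<le> 1" using ym m y2 m2 by auto
    have "(1 - m\<^sup>2) * \<bar>f'' y\<bar> \<le> (1 - y\<^sup>2) * \<bar>f'' y\<bar>" using y2 by (intro mult_right_mono) auto
    also have "\<dots> = \<bar>(1 - y\<^sup>2) * f'' y\<bar>" using y1 by (simp add: abs_mult)
    also have "\<dots> \<le> \<bar>2 * a + 2\<bar> * \<bar>y\<bar> * \<bar>f' y\<bar> + \<bar>c\<^sup>2 * y\<^sup>2 - r\<bar> * \<bar>f y\<bar>"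
      unfolding f(4)[OF y] by (rule order_trans[OF abs_triangle_ineq]) (simp add: abs_mult)
    also have "\<dots> \<le> L * \<bar>f' y\<bar> + L * \<bar>f y\<bar>"
    proof (intro add_mono mult_right_mono)
      have "\<bar>2 * a + 2\<bar> * \<bar>y\<bar> \<le> \<bar>2 * a + 2\<bar> * 1" using y1 by (intro mult_left_mono) auto
      also have "\<dots> \<le> L" unfolding L_def using zero_le_power2[of c] by simp
      finally show "\<bar>2 * a + 2\<bar> * \<bar>y\<bar> \<le> L" .
      have "c\<^sup>2 * y\<^sup>2 \<le> c\<^sup>2 * 1" using y1 by (intro mult_left_mono) auto
      moreover have "0 \<le> c\<^sup>2 * y\<^sup>2" by simp
      ultimately show "\<bar>c\<^sup>2 * y\<^sup>2 - r\<bar> \<le> L" unfolding L_def by linarith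
    qed auto
    finally have "(1 - m\<^sup>2) * \<bar>f'' y\<bar> \<le> L * \<bar>f y\<bar> + L * \<bar>f' y\<bar>" by simp
    then have "\<bar>f'' y\<bar> \<le> (L * \<bar>f y\<bar> + L * \<bar>f' y\<bar>) / (1 - m\<^sup>2)"
      using m2 by (simp add: pos_le_divide_eq mult.commute)
    then show ?thesis by (simp add: add_divide_distrib)
  qed
  from linear_ode_zero[OF f(2,3) this x0 x] show ?thesis by blast
qed

lemma prolate_ode_vanish_right:
  assumes ode: "prolate_ode c a r {0..1} f f'" and x0: "x0 \<in> {0..<1}" "f x0 = 0" "f' x0 = 0"
    and x: "x \<in> {0..1}"
  shows "f x = 0"
proof -
  have *: "f y = 0" if "y \<in> {0..<1}" for y
  proof -
    have "prolate_ode c a r {0..max x0 y} f f'"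
      by (rule prolate_ode_subset[OF ode]) (use that x0 in auto)
    from prolate_ode_unique[OF this _ _ _ x0(2,3), of y] show ?thesis using that x0 by auto
  qed
  have cont: "continuous_on {0..1} f"
    by (rule prolate_ode_continuous[OF ode])
  have "f 1 = 0"
  proof (rule continuous_constant_on_closure[of "{0..<1}" f])
    show "continuous_on (closure {0..<1}) f" using cont by simp
  qed (use * in auto)
  then show ?thesis using * x by (cases "x = 1") auto
qed

text \<open>Vanishing data at \<open>x\<close> would propagate up to the endpoint, where the
  solution has value \<open>1\<close>.\<close>

lemma radial_nondegenerate:
  assumes "a > - (1 / 2)" "0 \<le> x" "x < 1"
  shows "radial c r a x \<noteq> 0 \<or> radial' c r a x \<noteq> 0"
proof (rule ccontr)
  assume "\<not> ?thesis"
  moreover have "prolate_ode c a r {0..1} (radial c r a) (radial' c r a)"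
    by (rule prolate_ode_subset[OF prolate_ode_radial[OF assms(1)]]) auto
  ultimately have "radial c r a 1 = 0"
    using assms prolate_ode_vanish_right[of c a r "radial c r a" "radial' c r a" x 1] by simp
  then show False by simp
qed

text \<open>The factor \<open>1 - x\<^sup>2\<close> kills the boundary term at \<open>1\<close>, so that only the Wronskian at \<open>0\<close> survives.\<close>
lemma wronskian_integral:
  assumes f: "prolate_ode c a r {0..1} f f'" and g: "prolate_ode c b s {0..1} g g'" and a: "a \<ge> 0"
  shows "((\<lambda>x. gweight a x * ((s - r) * f x * g x + 2 * (a - b) * x * f x * g' x))
      has_integral (f 0 * g' 0 - f' 0 * g 0)) {0..1}"
proof -
  obtain f'' where f'': "continuous_on {0..1} f''"
     "\<And>x. x \<in> {0..1} \<Longrightarrow> (f has_real_derivative f' x) (at x within {0..1})"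
     "\<And>x. x \<in> {0..1} \<Longrightarrow> (f' has_real_derivative f'' x) (at x within {0..1})"
     "\<And>x. x \<in> {0..1} \<Longrightarrow> (1 - x\<^sup>2) * f'' x = (2 * a + 2) * x * f' x + (c\<^sup>2 * x\<^sup>2 - r) * f x"
    by (rule prolate_odeE[OF f], rule that)
  obtain g'' where g'': "continuous_on {0..1} g''"
     "\<And>x. x \<in> {0..1} \<Longrightarrow> (g has_real_derivative g' x) (at x within {0..1})"
     "\<And>x. x \<in> {0..1} \<Longrightarrow> (g' has_real_derivative g'' x) (at x within {0..1})"
     "\<And>x. x \<in> {0..1} \<Longrightarrow> (1 - x\<^sup>2) * g'' x = (2 * b + 2) * x * g' x + (c\<^sup>2 * x\<^sup>2 - s) * g x"
    by (rule prolate_odeE[OF g], rule that)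
  define F where "F x = - ((1 - x\<^sup>2) * gweight a x) * (f x * g' x - f' x * g x)" for x
  have "((\<lambda>x. gweight a x * ((s - r) * f x * g x + 2 * (a - b) * x * f x * g' x))
      has_integral (F 1 - F 0)) {0..1}"
  proof (rule fundamental_theorem_of_calculus_interior)
    have "continuous_on {0..1} (gweight a)"
      by (rule continuous_on_subset[OF continuous_on_gweight[OF a]]) auto
    moreover have "continuous_on {0..1} f" "continuous_on {0..1} f'"
        "continuous_on {0..1} g" "continuous_on {0..1} g'"
      by (rule prolate_ode_continuous[OF f] prolate_ode_continuous[OF g])+
    ultimately show "continuous_on {0..1} F"
      unfolding F_def by (intro continuous_intros)
  next
    fix x :: real
    assume x: "x \<in> {0<..<1}"
    then have xI: "x \<in> {0..1}" and at: "at x within {0..1} = at x"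
      by (auto intro: at_within_Icc_at)
    note d = f''(2,3)[OF xI, unfolded at] g''(2,3)[OF xI, unfolded at]
    have wr: "((\<lambda>x. f x * g' x - f' x * g x) has_real_derivative f x * g'' x - f'' x * g x) (at x)"
      by (auto intro!: derivative_eq_intros d)
    have fl: "((\<lambda>x. (1 - x\<^sup>2) * gweight a x) has_real_derivative - (2 * a + 2) * x * gweight a x) (at x)"
      by (rule gweight_flux_deriv) (use x in auto)
    have "(F has_real_derivative
        - ((- (2 * a + 2) * x * gweight a x) * (f x * g' x - f' x * g x)
           + (f x * g'' x - f'' x * g x) * ((1 - x\<^sup>2) * gweight a x))) (at x)"
      using DERIV_minus[OF DERIV_mult[OF fl wr]] unfolding F_def by simp
    moreover have "- ((- (2 * a + 2) * x * gweight a x) * (f x * g' x - f' x * g x)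
           + (f x * g'' x - f'' x * g x) * ((1 - x\<^sup>2) * gweight a x))
        = gweight a x * ((2 * a + 2) * x * (f x * g' x - f' x * g x)
            - f x * ((1 - x\<^sup>2) * g'' x) + g x * ((1 - x\<^sup>2) * f'' x))"
      by (simp add: algebra_simps)
    moreover have "\<dots> = gweight a x * ((s - r) * f x * g x + 2 * (a - b) * x * f x * g' x)"
      unfolding f''(4)[OF xI] g''(4)[OF xI] by (simp add: algebra_simps)
    ultimately show "(F has_vector_derivative
        gweight a x * ((s - r) * f x * g x + 2 * (a - b) * x * f x * g' x)) (at x)"
      by (simp add: has_real_derivative_iff_has_vector_derivative)
  qed simp
  then show ?thesis by (simp add: F_def)
qed

text \<open>For equal parameters the integrand of \<open>wronskian_integral\<close> is zero, so the
  Wronskian with \<open>radial\<close> vanishes at \<open>0\<close>. This uses regularity of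
  \<open>f\<close> up to \<open>1\<close>, which excludes the second, singular solution.\<close>

lemma prolate_ode_proportional:
  assumes f: "prolate_ode c a r {0..1} f f'" and a: "a \<ge> 0"
  shows "\<exists>k. (\<forall>x\<in>{0..1}. f x = k * radial c r a x) \<and> f' 0 = k * radial' c r a 0"
proof -
  let ?u = "radial c r a" and ?v = "radial' c r a"
  have u: "prolate_ode c a r {0..1} ?u ?v"
    by (rule prolate_ode_subset[OF prolate_ode_radial]) (use a in auto)
  have "f 0 * ?v 0 - f' 0 * ?u 0 = 0"
    using wronskian_integral[OF f u a] by (simp add: has_integral_unique[OF _ has_integral_0])
  moreover have "?u 0 \<noteq> 0 \<or> ?v 0 \<noteq> 0" using a by (intro radial_nondegenerate) auto
  ultimately obtain k where k: "f 0 = k * ?u 0" "f' 0 = k * ?v 0"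
  proof (cases "?u 0 = 0")
    case True
    with \<open>f 0 * ?v 0 - f' 0 * ?u 0 = 0\<close> \<open>?u 0 \<noteq> 0 \<or> ?v 0 \<noteq> 0\<close> show ?thesis
      by (intro that[of "f' 0 / ?v 0"]) auto
  next
    case False
    with \<open>f 0 * ?v 0 - f' 0 * ?u 0 = 0\<close> show ?thesis
      by (intro that[of "f 0 / ?u 0"]) (auto simp: field_simps)
  qed
  have "f x = k * ?u x" if "x \<in> {0..1}" for x
    using prolate_ode_vanish_right[OF prolate_ode_lincomb[OF f u, of 1 "- k"], of 0 x] k that by simp
  with k show ?thesis by blast
qed

section \<open>The Pruefer angle\<close>

lemma prolate_ode_radial_right:
  "a \<ge> 0 \<Longrightarrow> prolate_ode c a r {0..1} (radial c r a) (radial' c r a)"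
  by (rule prolate_ode_subset[OF prolate_ode_radial]) auto

text \<open>For \<open>r \<le> 0\<close> the flux \<open>G = (1 - x^2) * w * u * u'\<close>
  increases to its value 0 at \<open>1\<close>. Hence \<open>u * u' \<le> 0\<close>, and
  \<open>u^2\<close> decreases to its value 1. This fixes the branch of the angle.\<close>

lemma radial_nonpos_eigenvalue:
  assumes c: "c > 0" and r: "r \<le> 0" and a: "a \<ge> 0"
  shows "x \<in> {0..1} \<Longrightarrow> (radial c r a x)\<^sup>2 \<ge> 1" and "radial c r a 0 * radial' c r a 0 < 0"
proof -
  let ?u = "radial c r a" and ?v = "radial' c r a"
  note ode = prolate_ode_radial_right[OF a, of c r]
  obtain w where w: "continuous_on {0..1} w"
     "\<And>x. x \<in> {0..1} \<Longrightarrow> (?u has_real_derivative ?v x) (at x within {0..1})"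
     "\<And>x. x \<in> {0..1} \<Longrightarrow> (?v has_real_derivative w x) (at x within {0..1})"
     "\<And>x. x \<in> {0..1} \<Longrightarrow> (1 - x\<^sup>2) * w x = (2 * a + 2) * x * ?v x + (c\<^sup>2 * x\<^sup>2 - r) * ?u x"
    by (rule prolate_odeE[OF ode], rule that)
  have at: "at x within {0..1} = at x" if "0 < x" "x < 1" for x :: real
    using that by (intro at_within_Icc_at)
  define G where "G x = (1 - x\<^sup>2) * gweight a x * (?u x * ?v x)" for x
  have dG: "(G has_real_derivative gweight a x * ((1 - x\<^sup>2) * (?v x)\<^sup>2 + (c\<^sup>2 * x\<^sup>2 - r) * (?u x)\<^sup>2)) (at x)"
    if x: "0 < x" "x < 1" for x
  proof -
    have xI: "x \<in> {0..1}" using x by auto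
    note d = w(2,3)[OF xI, unfolded at[OF x]]
    have wr: "((\<lambda>x. ?u x * ?v x) has_real_derivative (?v x)\<^sup>2 + ?u x * w x) (at x)"
      by (auto intro!: derivative_eq_intros d simp: power2_eq_square)
    have fl: "((\<lambda>x. (1 - x\<^sup>2) * gweight a x) has_real_derivative - (2 * a + 2) * x * gweight a x) (at x)"
      by (rule gweight_flux_deriv) (use x in auto)
    have "- (2 * a + 2) * x * gweight a x * (?u x * ?v x) + ((?v x)\<^sup>2 + ?u x * w x) * ((1 - x\<^sup>2) * gweight a x)
        = gweight a x * ((1 - x\<^sup>2) * (?v x)\<^sup>2 - (2 * a + 2) * x * ?u x * ?v x + ?u x * ((1 - x\<^sup>2) * w x))"
      by (simp add: algebra_simps)
    also have "\<dots> = gweight a x * ((1 - x\<^sup>2) * (?v x)\<^sup>2 + (c\<^sup>2 * x\<^sup>2 - r) * (?u x)\<^sup>2)"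
      unfolding w(4)[OF xI] by (simp add: algebra_simps power2_eq_square)
    finally show ?thesis
      using DERIV_mult[OF fl wr] unfolding G_def[abs_def] by simp
  qed
  have contG: "continuous_on {0..1} G"
    unfolding G_def
    by (intro continuous_intros prolate_ode_continuous[OF ode]
        continuous_on_subset[OF continuous_on_gweight[OF a]]) auto
  have uv: "?u y * ?v y \<le> 0" if y: "0 \<le> y" "y < 1" for y
  proof -
    have "G y \<le> G 1"
    proof (rule DERIV_nonneg_imp_increasing_open[where f = G])
      fix x assume "y < x" "x < 1"
      then have x: "0 < x" "x < 1" using y by auto
      show "\<exists>d. (G has_real_derivative d) (at x) \<and> 0 \<le> d"
        by (rule exI, rule conjI, rule dG[OF x])
           (use x order_trans[OF r, of "c\<^sup>2 * x\<^sup>2"] square_le_1[of x] in \<open>auto intro!: mult_nonneg_nonneg add_nonneg_nonneg\<close>)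
    qed (use y contG in \<open>auto intro: continuous_on_subset\<close>)
    then have "(1 - y\<^sup>2) * gweight a y * (?u y * ?v y) \<le> 0" by (simp add: G_def)
    moreover have "(1 - y\<^sup>2) * gweight a y > 0"
      using y square_lt_1[of y] gweight_pos[of y a] by (intro mult_pos_pos) auto
    ultimately show ?thesis by (meson mult_pos_pos not_le)
  qed
  have ge1: "(?u x)\<^sup>2 \<ge> 1" if x: "x \<in> {0..1}" for x
  proof -
    have "(?u 1)\<^sup>2 \<le> (?u x)\<^sup>2"
    proof (rule DERIV_nonpos_imp_decreasing_open[where f = "\<lambda>x. (?u x)\<^sup>2"])
      fix y assume "x < y" "y < 1"
      then have y: "0 < y" "y < 1" using x by auto
      have yI: "y \<in> {0..1}" using y by auto
      have "((\<lambda>x. (?u x)\<^sup>2) has_real_derivative 2 * (?u y * ?v y)) (at y)"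
        using w(2)[OF yI, unfolded at[OF y]] by (auto intro!: derivative_eq_intros)
      moreover have "2 * (?u y * ?v y) \<le> 0" using uv[of y] y by auto
      ultimately show "\<exists>d. ((\<lambda>x. (?u x)\<^sup>2) has_real_derivative d) (at y) \<and> d \<le> 0" by blast
    next
      show "continuous_on {x..1} (\<lambda>x. (?u x)\<^sup>2)"
        using x by (intro continuous_intros continuous_on_subset[OF prolate_ode_continuous(1)[OF ode]]) auto
    qed (use x in auto)
    then show ?thesis by simp
  qed
  show "x \<in> {0..1} \<Longrightarrow> (?u x)\<^sup>2 \<ge> 1" by (rule ge1)
  \<comment> \<open>Strictness comes from \<open>c > 0\<close>. As \<open>G 1 = 0\<close> and all
    factors but \<open>u * u'\<close> equal 1 at \<open>0\<close>, the sign of \<open>G 0\<close> is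
    the claim.\<close>
  have "G 0 < G 1"
  proof (rule DERIV_pos_imp_increasing_open[where f = G])
    fix x :: real assume x: "0 < x" "x < 1"
    have "(?u x)\<^sup>2 > 0" using ge1[of x] x by (auto intro: less_le_trans[OF zero_less_one])
    moreover have "c\<^sup>2 * x\<^sup>2 > 0" using c x by simp
    ultimately have 1: "(c\<^sup>2 * x\<^sup>2 - r) * (?u x)\<^sup>2 > 0"
      using r by (intro mult_pos_pos) auto
    have 2: "(1 - x\<^sup>2) * (?v x)\<^sup>2 \<ge> 0" using square_le_1[of x] x by (intro mult_nonneg_nonneg) auto
    have "gweight a x > 0" using x by (intro gweight_pos) auto
    from mult_pos_pos[OF this add_nonneg_pos[OF 2 1]]
    have "gweight a x * ((1 - x\<^sup>2) * (?v x)\<^sup>2 + (c\<^sup>2 * x\<^sup>2 - r) * (?u x)\<^sup>2) > 0" .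
    with dG[OF x] show "\<exists>d. (G has_real_derivative d) (at x) \<and> 0 < d" by blast
  qed (use contG in auto)
  then show "?u 0 * ?v 0 < 0" by (simp add: G_def)
qed

text \<open>Continuity and the polar form determine the angle only up to a constant multiple of
  2\<pi>. The last clause fixes this constant, so that the multiple of \<pi>/2 attained at an
  eigenvalue is its index and not merely its index up to a shift.\<close>

definition prufer_angle :: "real \<Rightarrow> (real \<Rightarrow> real \<Rightarrow> real) \<Rightarrow> bool" where
  "prufer_angle c \<theta> \<longleftrightarrow> continuous_on (UNIV \<times> {0..}) (\<lambda>p. \<theta> (fst p) (snd p)) \<and>
     (\<forall>r a. a \<ge> 0 \<longrightarrow> (\<exists>\<rho>>0. radial c r a 0 = \<rho> * cos (\<theta> r a) \<and> radial' c r a 0 = \<rho> * sin (\<theta> r a))) \<and>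
     (\<forall>r a. r \<le> 0 \<longrightarrow> a \<ge> 0 \<longrightarrow> - (pi / 2) < \<theta> r a \<and> \<theta> r a < 0)"

text \<open>\<open>u + i (1 - x\<^sup>2) u'\<close> never vanishes and equals \<open>1\<close> at \<open>x = 1\<close>; a continuous logarithm of it over the
  contractible space of all \<open>(x, r, a)\<close> measures the angle accumulated between \<open>1\<close> and \<open>0\<close>.\<close>
lemma prufer_angle_exists:
  assumes c: "c > 0"
  obtains \<theta> where "prufer_angle c \<theta>"
proof -
  define S where "S = {0..1::real} \<times> (UNIV :: real set) \<times> {0::real..}"
  define f where "f p = complex_of_real (radial c (fst (snd p)) (snd (snd p)) (fst p))
      + \<i> * complex_of_real ((1 - (fst p)\<^sup>2) * radial' c (fst (snd p)) (snd (snd p)) (fst p))"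
    for p :: "real \<times> real \<times> real"
  have sub: "S \<subseteq> {p. \<bar>1 - fst p\<bar> < 5 / 4 \<and> snd (snd p) > - (1 / 2)}"
    by (auto simp: S_def)
  have contf: "continuous_on S f"
    unfolding f_def
    by (intro continuous_intros continuous_on_subset[OF continuous_on_radial sub]
        continuous_on_subset[OF continuous_on_radial' sub])
  have Re_f: "Re (f (x, r, a)) = radial c r a x"
    and Im_f: "Im (f (x, r, a)) = (1 - x\<^sup>2) * radial' c r a x" for x r a
    by (simp_all add: f_def)
  have nz: "f p \<noteq> 0" if "p \<in> S" for p
  proof -
    obtain x r a where p: "p = (x, r, a)" by (cases p)
    have x: "0 \<le> x" "x \<le> 1" and a: "a \<ge> 0" using that by (auto simp: S_def p)
    show ?thesis
    proof (cases "x = 1")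
      case True
      then have "Re (f p) = 1" by (simp add: p Re_f)
      then show ?thesis by auto
    next
      case False
      then have "radial c r a x \<noteq> 0 \<or> (1 - x\<^sup>2) * radial' c r a x \<noteq> 0"
        using radial_nondegenerate[of a x c r] x a square_lt_1[of x] by auto
      then show ?thesis unfolding p complex_eq_iff Re_f Im_f by simp
    qed
  qed
  have "convex S" unfolding S_def by (intro convex_Times convex_real_interval convex_UNIV)
  then obtain g where contg: "continuous_on S g" and g: "\<And>p. p \<in> S \<Longrightarrow> f p = exp (g p)"
    using continuous_logarithm_on_contractible[OF contf convex_imp_contractible nz] by metis
  \<comment> \<open>\<open>f\<close> is \<open>1\<close> at \<open>x = 1\<close>, so
    \<open>g (1, r, a)\<close> is a multiple of 2\<pi>i; subtracting it makes the angle at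
    \<open>x = 1\<close> exactly 0.\<close>
  define h where "h x r a = g (x, r, a) - g (1, r, a)" for x r a
  have h: "exp (h x r a) = f (x, r, a)" if "x \<in> {0..1}" "a \<ge> 0" for x r a
  proof -
    have "exp (h x r a) = f (x, r, a) / f (1, r, a)"
      using that by (simp add: h_def exp_diff g S_def)
    also have "f (1, r, a) = 1" by (simp add: f_def)
    finally show ?thesis by simp
  qed
  define \<theta> where "\<theta> r a = Im (h 0 r a)" for r a
  have polar: "radial c r a x = exp (Re (h x r a)) * cos (Im (h x r a))"
     "(1 - x\<^sup>2) * radial' c r a x = exp (Re (h x r a)) * sin (Im (h x r a))"
    if "x \<in> {0..1}" "a \<ge> 0" for x r a
    using h[OF that, of r] Re_f[of x r a] Im_f[of x r a] by (metis Re_exp, metis Im_exp)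
  have "- (pi / 2) < \<theta> r a \<and> \<theta> r a < 0" if r: "r \<le> 0" and a: "a \<ge> 0" for r a
  proof -
    note nonpos = radial_nonpos_eigenvalue[OF c r a]
    have cont: "continuous_on {0..1} (\<lambda>x. Im (h x r a))"
      unfolding h_def
      by (intro continuous_intros continuous_on_compose2[OF contg]) (use a in \<open>auto simp: S_def\<close>)
    \<comment> \<open>For \<open>r \<le> 0\<close> the solution has no zero, so the angle, which is
      0 at \<open>x = 1\<close>, cannot cross plus or minus \<pi>/2 on its way to
      \<open>x = 0\<close>.\<close>
    have cosnz: "cos (Im (h x r a)) \<noteq> 0" if x: "0 \<le> x" "x \<le> 1" for x
    proof
      assume "cos (Im (h x r a)) = 0"
      then have "radial c r a x = 0" using polar(1)[of x a r] x a by simp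
      with nonpos(1)[of x] x show False by simp
    qed
    have h1: "Im (h 1 r a) = 0" by (simp add: h_def)
    have up: "\<theta> r a < pi / 2"
    proof (rule ccontr)
      assume "\<not> ?thesis"
      then obtain x where x: "0 \<le> x" "x \<le> 1" "Im (h x r a) = pi / 2"
        using IVT2'[of "\<lambda>x. Im (h x r a)" 1 "pi / 2" 0] cont h1 by (auto simp: \<theta>_def)
      then show False using cosnz[OF x(1,2)] cos_pi_half by metis
    qed
    have down: "- (pi / 2) < \<theta> r a"
    proof (rule ccontr)
      assume "\<not> ?thesis"
      then obtain x where x: "0 \<le> x" "x \<le> 1" "Im (h x r a) = - (pi / 2)"
        using IVT'[of "\<lambda>x. Im (h x r a)" 0 "- (pi / 2)" 1] cont h1 by (auto simp: \<theta>_def)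
      then show False using cosnz[OF x(1,2)] cos_pi_half cos_minus by metis
    qed
    have "\<theta> r a < 0"
    proof (rule ccontr)
      assume "\<not> ?thesis"
      then have "sin (\<theta> r a) \<ge> 0" "cos (\<theta> r a) \<ge> 0"
        using up pi_gt_zero by (auto intro!: sin_ge_zero cos_ge_zero)
      then have "radial c r a 0 * radial' c r a 0 \<ge> 0"
        using polar[of 0 a r] a by (simp add: \<theta>_def)
      with nonpos(2) show False by simp
    qed
    with down show ?thesis by simp
  qed
  moreover have "\<exists>\<rho>>0. radial c r a 0 = \<rho> * cos (\<theta> r a) \<and> radial' c r a 0 = \<rho> * sin (\<theta> r a)" if "a \<ge> 0" for r a
    using polar[of 0 a r] that by (intro exI[of _ "exp (Re (h 0 r a))"]) (auto simp: \<theta>_def)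
  moreover have "continuous_on (UNIV \<times> {0..}) (\<lambda>p. \<theta> (fst p) (snd p))"
    unfolding \<theta>_def h_def
    by (intro continuous_intros continuous_on_compose2[OF contg]) (auto simp: S_def)
  ultimately show ?thesis using that[of \<theta>] unfolding prufer_angle_def by blast
qed

section \<open>Monotonicity of the angle\<close>

text \<open>Near each point only comparisons with that point itself are available; in a short
  interval around it, transitivity through the point compares the two ends. Used for the angle and
  again for the Fourier eigenvalues.\<close>

lemma local_order_imp_global:
  fixes R :: "real \<Rightarrow> real \<Rightarrow> bool"
  assumes trans: "\<And>x y z. R x y \<Longrightarrow> R y z \<Longrightarrow> R x z"
    and local: "\<And>x. x \<in> {A..B} \<Longrightarrow>
      \<exists>d>0. \<forall>y\<in>{A..B}. \<bar>y - x\<bar> < d \<longrightarrow> (x < y \<longrightarrow> R x y) \<and> (y < x \<longrightarrow> R y x)"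
    and "A < B"
  shows "R A B"
proof -
  define P where "P s t \<longleftrightarrow> (A \<le> s \<and> t \<le> B \<and> s < t \<longrightarrow> R s t)" for s t
  have "A \<le> B" using \<open>A < B\<close> by simp
  then have "P A B"
  proof (induction rule: Bolzano)
    case (trans a b c)
    then show ?case
      unfolding P_def using assms(1)[of a b c] by (cases "a = b"; cases "b = c") auto
  next
    case (local x)
    then obtain d where d: "d > 0"
      "\<forall>y\<in>{A..B}. \<bar>y - x\<bar> < d \<longrightarrow> (x < y \<longrightarrow> R x y) \<and> (y < x \<longrightarrow> R y x)"
      using assms(2)[of x] by auto
    have "P s t" if "s \<le> x" "x \<le> t" "t - s < d" for s t
      unfolding P_def
    proof
      assume st: "A \<le> s \<and> t \<le> B \<and> s < t"
      have 1: "s < x \<longrightarrow> R s x" using d(2) st that by auto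
      have 2: "x < t \<longrightarrow> R x t" using d(2) st that by auto
      show "R s t" using 1 2 st that assms(1)[of s x t] by (cases "s = x"; cases "x = t") auto
    qed
    then show ?case using d(1) by blast
  qed
  then show ?thesis using \<open>A < B\<close> by (simp add: P_def)
qed

lemma gweight_deriv_nonpos:
  assumes a: "a \<ge> 0" and x: "0 \<le> x" "x < 1"
  shows "\<exists>d\<le>0. (gweight a has_real_derivative d) (at x)"
proof (cases "a = 0")
  case True
  then have "gweight a = (\<lambda>_. 1)" by (simp add: gweight_def fun_eq_iff)
  then show ?thesis by auto
next
  case False
  have pos: "1 - x\<^sup>2 > 0" using square_lt_1[of x] x by simp
  have "((\<lambda>x. (1 - x\<^sup>2) powr a) has_real_derivative a * (1 - x\<^sup>2) powr (a - 1) * (- 2 * x)) (at x)"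
    using pos by (auto intro!: derivative_eq_intros)
  moreover have "gweight a = (\<lambda>x. (1 - x\<^sup>2) powr a)" using False by (simp add: gweight_def fun_eq_iff)
  moreover have "a * (1 - x\<^sup>2) powr (a - 1) * (- 2 * x) \<le> 0"
    using mult_nonneg_nonpos[of "a * (1 - x\<^sup>2) powr (a - 1)" "- 2 * x"] a x by simp
  ultimately show ?thesis by metis
qed

text \<open>The integrand is the combination of \<open>w * u^2\<close> and
  \<open>e = w * (x * u^2)'\<close> with coefficients \<open>1 - k / 2\<close> and
  \<open>k / 2\<close>. Partial integration of \<open>e\<close> leaves a nonnegative boundary term
  and \<open>- x * u^2 * w'\<close>, which is nonnegative since the weight decreases on the right
  half. Here \<open>k = 0\<close> belongs to a fixed exponent and \<open>k = 1\<close> to the line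
  \<open>r + 2 * a = const\<close>.\<close>

lemma radial_energy_pos:
  assumes a: "a \<ge> 0" and k: "0 \<le> k" "k \<le> 1"
  shows "integral {0..1} (\<lambda>x. gweight a x * (radial c r a x * radial c r a x
      + k * x * radial c r a x * radial' c r a x)) > 0"
proof -
  let ?u = "radial c r a" and ?v = "radial' c r a" and ?w = "gweight a"
  note ode = prolate_ode_radial_right[OF a, of c r]
  have cw: "continuous_on {0..1} ?w"
    by (rule continuous_on_subset[OF continuous_on_gweight[OF a]]) auto
  note cont = cw prolate_ode_continuous[OF ode]
  define e where "e x = ?w x * ((?u x)\<^sup>2 + 2 * x * ?u x * ?v x)" for x
  have ce: "continuous_on {0..1} e" unfolding e_def by (intro continuous_intros cont)
  define D where "D s = integral {0..s} e - s * (?u s)\<^sup>2 * ?w s" for s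
  have "D 0 \<le> D 1"
  proof (rule DERIV_nonneg_imp_increasing_open[where f = D])
    fix s :: real assume s: "0 < s" "s < 1"
    then have sI: "s \<in> {0..1}" and at: "at s within {0..1} = at s" by (auto intro: at_within_Icc_at)
    have i: "((\<lambda>s. integral {0..s} e) has_real_derivative e s) (at s)"
      using integral_has_real_derivative[OF ce sI] by (simp add: at)
    obtain d where d: "d \<le> 0" "(?w has_real_derivative d) (at s)"
      using gweight_deriv_nonpos[OF a, of s] s by auto
    have u: "(?u has_real_derivative ?v s) (at s)"
      using ode sI at by (auto elim!: prolate_odeE)
    have "(D has_real_derivative - (s * (?u s)\<^sup>2 * d)) (at s)"
      unfolding D_def
      by (auto intro!: derivative_eq_intros i d(2) u simp: e_def power2_eq_square algebra_simps)
    moreover have "- (s * (?u s)\<^sup>2 * d) \<ge> 0"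
      using d s by (simp add: mult_nonneg_nonpos)
    ultimately show "\<exists>y. (D has_real_derivative y) (at s) \<and> 0 \<le> y" by blast
  next
    have "continuous_on {0..1} (\<lambda>s. integral {0..s} e)"
      by (rule indefinite_integral_continuous_1[OF integrable_continuous_real[OF ce]])
    then show "continuous_on {0..1} D" unfolding D_def by (intro continuous_intros cont)
  qed auto
  then have e0: "integral {0..1} e \<ge> 0" by (simp add: D_def) (metis gweight_nonneg order_trans)
  have cu: "continuous_on {0..1} (\<lambda>x. ?w x * (?u x)\<^sup>2)" by (intro continuous_intros cont)
  have "integral {0..1} (\<lambda>x. ?w x * (?u x)\<^sup>2) \<ge> 0"
    by (rule integral_nonneg[OF integrable_continuous_real[OF cu]]) auto
  moreover have "integral {0..1} (\<lambda>x. ?w x * (?u x)\<^sup>2) \<noteq> 0"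
  proof
    assume "integral {0..1} (\<lambda>x. ?w x * (?u x)\<^sup>2) = 0"
    then have z: "?w x * (?u x)\<^sup>2 = 0" if "x \<in> {0..1}" for x
      using integral_eq_0_iff[OF cu] that by auto
    have uz: "?u x = 0" if "x \<in> {0..<1}" for x
      using z[of x] gweight_pos[of x a] that by auto
    have "continuous_on (closure {0..<1}) ?u" using cont(2) by simp
    from continuous_constant_on_closure[OF this uz, of 1] have "?u 1 = 0" by simp
    then show False by simp
  qed
  ultimately have u0: "integral {0..1} (\<lambda>x. ?w x * (?u x)\<^sup>2) > 0" by simp
  have "(\<lambda>x. ?w x * (?u x * ?u x + k * x * ?u x * ?v x))
      = (\<lambda>x. (1 - k / 2) * (?w x * (?u x)\<^sup>2) + (k / 2) * e x)"
    by (simp add: e_def fun_eq_iff power2_eq_square algebra_simps)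
  then have "integral {0..1} (\<lambda>x. ?w x * (?u x * ?u x + k * x * ?u x * ?v x))
      = (1 - k / 2) * integral {0..1} (\<lambda>x. ?w x * (?u x)\<^sup>2) + (k / 2) * integral {0..1} e"
    by (simp only:) (intro integral_unique has_integral_add has_integral_mult_right
        integrable_integral integrable_continuous_real cu ce)
  also have "\<dots> > 0" using k u0 e0 by (intro add_pos_nonneg mult_pos_pos mult_nonneg_nonneg) auto
  finally show ?thesis .
qed

lemma continuous_on_radial_param:
  assumes "continuous_on T p" "continuous_on T q" "\<And>t. t \<in> T \<Longrightarrow> q t \<ge> 0"
  shows "continuous_on (T \<times> {0..1}) (\<lambda>z. radial c (p (fst z)) (q (fst z)) (snd z))"
    and "continuous_on (T \<times> {0..1}) (\<lambda>z. radial' c (p (fst z)) (q (fst z)) (snd z))"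
proof -
  have path: "continuous_on (T \<times> {0..1}) (\<lambda>z. (snd z, p (fst z), q (fst z)))"
    by (intro continuous_intros continuous_on_compose2[OF assms(1)] continuous_on_compose2[OF assms(2)]) auto
  have sub: "(\<lambda>z. (snd z, p (fst z), q (fst z))) ` (T \<times> {0..1})
      \<subseteq> {p :: real \<times> real \<times> real. \<bar>1 - fst p\<bar> < 5 / 4 \<and> snd (snd p) > - (1 / 2)}"
    using assms(3) by (fastforce intro: less_le_trans[of _ 0])
  show "continuous_on (T \<times> {0..1}) (\<lambda>z. radial c (p (fst z)) (q (fst z)) (snd z))"
    using continuous_on_compose2[OF continuous_on_radial path sub] by simp
  show "continuous_on (T \<times> {0..1}) (\<lambda>z. radial' c (p (fst z)) (q (fst z)) (snd z))"
    using continuous_on_compose2[OF continuous_on_radial' path sub] by simp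
qed

text \<open>Translates the sign of the Wronskian into the order of two angles, provided that they
  differ by less than \<pi>; the factor is the product of the two moduli.\<close>

lemma prufer_angle_wronskian:
  assumes "prufer_angle c \<theta>" "a \<ge> 0" "b \<ge> 0"
  obtains \<rho> where "\<rho> > 0"
    "radial c r a 0 * radial' c s b 0 - radial' c r a 0 * radial c s b 0 = \<rho> * sin (\<theta> s b - \<theta> r a)"
proof -
  have polar: "\<exists>\<rho>>0. radial c r a 0 = \<rho> * cos (\<theta> r a) \<and> radial' c r a 0 = \<rho> * sin (\<theta> r a)"
    if "a \<ge> 0" for r a
    using assms(1) that unfolding prufer_angle_def by blast
  obtain x where "x > 0" "radial c r a 0 = x * cos (\<theta> r a)" "radial' c r a 0 = x * sin (\<theta> r a)"
    using polar[OF assms(2)] by blast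
  moreover obtain y where "y > 0" "radial c s b 0 = y * cos (\<theta> s b)" "radial' c s b 0 = y * sin (\<theta> s b)"
    using polar[OF assms(3)] by blast
  ultimately show ?thesis
    by (intro that[of "x * y"]) (auto simp: sin_diff algebra_simps)
qed

text \<open>The Wronskian of the solutions at two nearby points of the path is the increment of \<open>t\<close> times a
  number close to the positive energy of \<open>radial_energy_pos\<close>.\<close>
lemma prufer_angle_path_less:
  assumes \<theta>: "prufer_angle c \<theta>" and k: "0 \<le> k" "k \<le> 1" and t: "t1 < t2" and a0: "a0 - k * t2 / 2 \<ge> 0"
  shows "\<theta> (r0 + t1) (a0 - k * t1 / 2) < \<theta> (r0 + t2) (a0 - k * t2 / 2)"
proof -
  define p where "p t = r0 + t" for t
  define q where "q t = a0 - k * t / 2" for t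
  define \<phi> where "\<phi> t = \<theta> (p t) (q t)" for t
  have q: "q t \<ge> 0" if "t \<in> {t1..t2}" for t
  proof -
    have "k * t \<le> k * t2" using that k by (intro mult_left_mono) auto
    then show ?thesis using a0 by (simp add: q_def)
  qed
  have cp: "continuous_on {t1..t2} p" and cq: "continuous_on {t1..t2} q"
    unfolding p_def q_def by (auto intro!: continuous_intros)
  have c\<phi>: "continuous_on {t1..t2} \<phi>"
  proof -
    have "continuous_on (UNIV \<times> {0..}) (\<lambda>p. \<theta> (fst p) (snd p))"
      using \<theta> by (simp add: prufer_angle_def)
    moreover have "continuous_on {t1..t2} (\<lambda>t. (p t, q t))" by (intro continuous_intros cp cq)
    ultimately have "continuous_on {t1..t2} (\<lambda>t. \<theta> (fst (p t, q t)) (snd (p t, q t)))"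
      by (rule continuous_on_compose2) (use q in auto)
    then show ?thesis by (simp add: \<phi>_def[abs_def])
  qed
  have "\<phi> t1 < \<phi> t2"
  proof (rule local_order_imp_global[where R = "\<lambda>x y. \<phi> x < \<phi> y"])
    fix x assume x: "x \<in> {t1..t2}"
    let ?u = "\<lambda>t. radial c (p t) (q t)" and ?v = "\<lambda>t. radial' c (p t) (q t)"
    \<comment> \<open>Along the path \<open>2 * (q x - q y) = k * (y - x)\<close>, so the Wronskian
      of the solutions at \<open>x\<close> and \<open>y\<close> is \<open>(y - x) * J y\<close>.
      \<open>J x\<close> is the energy, and positivity persists for \<open>y\<close> near
      \<open>x\<close>.\<close>
    define J where "J y = integral {0..1} (\<lambda>s. gweight (q x) s * (?u x s * ?u y s + k * s * ?u x s * ?v y s))" for y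
    have cJ: "continuous_on {t1..t2} J"
    proof -
      have 1: "continuous_on ({t1..t2} \<times> {0..1}) (\<lambda>z. gweight (q x) (snd z))"
        by (rule continuous_on_compose2[OF continuous_on_gweight[OF q[OF x]]]) (auto intro!: continuous_intros)
      have 2: "continuous_on ({t1..t2} \<times> {0..1}) (\<lambda>z. ?u x (snd z))"
        by (rule continuous_on_compose2[OF prolate_ode_continuous(1)[OF prolate_ode_radial_right[OF q[OF x]]]])
           (auto intro!: continuous_intros)
      have "continuous_on ({t1..t2} \<times> cbox 0 1)
          (\<lambda>(y, s). gweight (q x) s * (?u x s * ?u y s + k * s * ?u x s * ?v y s))"
        unfolding split_beta box_real
        by (intro continuous_intros 1 2 continuous_on_radial_param[OF cp cq q])
      from integral_continuous_on_param[OF this] show ?thesis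
        unfolding J_def box_real .
    qed
    have "J x > 0" unfolding J_def by (rule radial_energy_pos[OF q[OF x] k])
    then obtain d1 where d1: "d1 > 0" "\<And>y. y \<in> {t1..t2} \<Longrightarrow> \<bar>y - x\<bar> < d1 \<Longrightarrow> \<bar>J y - J x\<bar> < J x"
      using cJ x unfolding continuous_on_iff dist_real_def by metis
    \<comment> \<open>Within distance \<pi> the sine of the difference has the sign of the
      difference.\<close>
    obtain d2 where d2: "d2 > 0" "\<And>y. y \<in> {t1..t2} \<Longrightarrow> \<bar>y - x\<bar> < d2 \<Longrightarrow> \<bar>\<phi> y - \<phi> x\<bar> < pi"
      using c\<phi> x pi_gt_zero unfolding continuous_on_iff dist_real_def by metis
    have main: "(x < y \<longrightarrow> \<phi> x < \<phi> y) \<and> (y < x \<longrightarrow> \<phi> y < \<phi> x)"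
      if y: "y \<in> {t1..t2}" "\<bar>y - x\<bar> < min d1 d2" for y
    proof -
      have Jy: "J y > 0" using d1(2)[of y] y by auto
      have close: "\<bar>\<phi> y - \<phi> x\<bar> < pi" using d2(2)[of y] y by auto
      have "((\<lambda>s. gweight (q x) s * ((p y - p x) * ?u x s * ?u y s + 2 * (q x - q y) * s * ?u x s * ?v y s))
          has_integral (?u x 0 * ?v y 0 - ?v x 0 * ?u y 0)) {0..1}"
        by (intro wronskian_integral[where c = c] prolate_ode_radial_right q x y)
      moreover have "(\<lambda>s. gweight (q x) s * ((p y - p x) * ?u x s * ?u y s + 2 * (q x - q y) * s * ?u x s * ?v y s))
          = (\<lambda>s. (y - x) * (gweight (q x) s * (?u x s * ?u y s + k * s * ?u x s * ?v y s)))"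
      proof
        fix s
        have "2 * (q x - q y) = (y - x) * k" by (simp add: q_def algebra_simps)
        moreover have "p y - p x = y - x" by (simp add: p_def)
        ultimately show "gweight (q x) s * ((p y - p x) * ?u x s * ?u y s + 2 * (q x - q y) * s * ?u x s * ?v y s)
          = (y - x) * (gweight (q x) s * (?u x s * ?u y s + k * s * ?u x s * ?v y s))"
          by (simp only: distrib_left mult_ac)
      qed
      ultimately have "((\<lambda>s. (y - x) * (gweight (q x) s * (?u x s * ?u y s + k * s * ?u x s * ?v y s)))
          has_integral (?u x 0 * ?v y 0 - ?v x 0 * ?u y 0)) {0..1}" by (simp only:)
      from integral_unique[OF this] have W: "?u x 0 * ?v y 0 - ?v x 0 * ?u y 0 = (y - x) * J y"
        by (simp add: J_def)
      obtain \<rho> where \<rho>: "\<rho> > 0" "(y - x) * J y = \<rho> * sin (\<phi> y - \<phi> x)"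
        using prufer_angle_wronskian[OF \<theta> q[OF x] q[OF y(1)], of "p x" "p y"] W
        unfolding \<phi>_def by metis
      show ?thesis
      proof (intro conjI impI; rule ccontr)
        assume "x < y" "\<not> \<phi> x < \<phi> y"
        then have "sin (\<phi> x - \<phi> y) \<ge> 0" using close by (intro sin_ge_zero) auto
        then have "\<rho> * sin (\<phi> y - \<phi> x) \<le> 0"
          using \<rho>(1) sin_minus[of "\<phi> x - \<phi> y"] by (simp add: mult_nonneg_nonpos)
        moreover have "(y - x) * J y > 0" using \<open>x < y\<close> Jy by simp
        ultimately show False using \<rho>(2) by simp
      next
        assume "y < x" "\<not> \<phi> y < \<phi> x"
        then have "sin (\<phi> y - \<phi> x) \<ge> 0" using close by (intro sin_ge_zero) auto
        then have "\<rho> * sin (\<phi> y - \<phi> x) \<ge> 0" using \<rho>(1) by simp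
        moreover have "(y - x) * J y < 0" using \<open>y < x\<close> Jy by (simp add: mult_neg_pos)
        ultimately show False using \<rho>(2) by simp
      qed
    qed
    show "\<exists>d>0. \<forall>y\<in>{t1..t2}. \<bar>y - x\<bar> < d \<longrightarrow> (x < y \<longrightarrow> \<phi> x < \<phi> y) \<and> (y < x \<longrightarrow> \<phi> y < \<phi> x)"
      by (rule exI[of _ "min d1 d2"]) (use main d1(1) d2(1) in auto)
  qed (use t in auto)
  then show ?thesis by (simp add: \<phi>_def p_def q_def)
qed

lemma prufer_angle_strict_mono:
  assumes "prufer_angle c \<theta>" "a \<ge> 0" "r < s"
  shows "\<theta> r a < \<theta> s a"
  using prufer_angle_path_less[OF assms(1), of 0 r s a 0] assms by simp

lemma prufer_angle_less_iff:
  assumes "prufer_angle c \<theta>" "a \<ge> 0"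
  shows "\<theta> r a < \<theta> s a \<longleftrightarrow> r < s"
  using prufer_angle_strict_mono[OF assms, of r s] prufer_angle_strict_mono[OF assms, of s r]
  by (cases r s rule: linorder_cases) auto

text \<open>This keeps the \<open>n\<close>-th eigenvalue from escaping to infinity when the exponent decreases.\<close>
lemma prufer_angle_decrease_exponent:
  assumes "prufer_angle c \<theta>" "0 \<le> b" "b \<le> a"
  shows "\<theta> r a \<le> \<theta> (r + 2 * (a - b)) b"
proof (cases "a = b")
  case False
  have b: "a - 1 * (2 * (a - b)) / 2 = b" by (simp add: field_simps)
  have "\<theta> (r + 0) (a - 1 * 0 / 2) < \<theta> (r + 2 * (a - b)) (a - 1 * (2 * (a - b)) / 2)"
    by (rule prufer_angle_path_less[OF assms(1)]) (use assms False b in auto)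
  then show ?thesis unfolding b by simp
qed auto

lemma prufer_angle_gt:
  assumes "prufer_angle c \<theta>" "a \<ge> 0"
  shows "\<theta> r a > - (pi / 2)"
proof (cases "r \<le> 0")
  case True
  then show ?thesis using assms by (simp add: prufer_angle_def)
next
  case False
  then have "\<theta> 0 a < \<theta> r a" using prufer_angle_strict_mono[OF assms, of 0 r] by simp
  moreover have "\<theta> 0 a > - (pi / 2)" using assms by (simp add: prufer_angle_def)
  ultimately show ?thesis by simp
qed

text \<open>The angle is negative at \<open>r = 0\<close>. Only values below one already attained
  are reached, which suffices to close the numbering downwards and to follow an eigenvalue to
  smaller exponents.\<close>

lemma prufer_angle_intermediate:
  assumes \<theta>: "prufer_angle c \<theta>" and a: "a \<ge> 0" and v: "0 \<le> v" "v \<le> \<theta> s a"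
  obtains r where "r \<le> s" "\<theta> r a = v"
proof -
  have z: "\<theta> 0 a < 0" using \<theta> a by (simp add: prufer_angle_def)
  then have "\<theta> 0 a < \<theta> s a" using v by simp
  then have s: "0 < s" using prufer_angle_less_iff[OF \<theta> a] by simp
  have "continuous_on (UNIV \<times> {0..}) (\<lambda>p. \<theta> (fst p) (snd p))"
    using \<theta> by (simp add: prufer_angle_def)
  moreover have "continuous_on {0..s} (\<lambda>t. (t, a))" by (intro continuous_intros)
  ultimately have "continuous_on {0..s} (\<lambda>t. \<theta> (fst (t, a)) (snd (t, a)))"
    by (rule continuous_on_compose2) (use a in auto)
  then have "\<exists>r\<ge>0. r \<le> s \<and> \<theta> r a = v"
    using IVT'[of "\<lambda>t. \<theta> t a" 0 v s] z v s by auto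
  then show ?thesis using that by auto
qed

section \<open>Eigenfunctions and their numbering\<close>

lemma deriv_I_eqI:
  assumes "x \<in> {-1..1}" "(f has_real_derivative d) (at x within {-1..1})"
  shows "deriv_I f x = d"
  unfolding deriv_I_def
  by (rule vector_derivative_within_closed_interval)
     (use assms in \<open>auto simp: has_real_derivative_iff_has_vector_derivative\<close>)

lemma differentiable_on_imp_deriv_I:
  assumes "f differentiable_on {-1..1}" "x \<in> {-1..1}"
  shows "(f has_real_derivative deriv_I f x) (at x within {-1..1})"
  using assms unfolding differentiable_on_def deriv_I_def has_real_derivative_iff_has_vector_derivative
  by (auto simp flip: vector_derivative_works)

lemma prolate_eigenfunction_iff:
  "prolate_eigenfunction a c r f \<longleftrightarrow> (\<exists>f'. prolate_ode c a r {-1..1} f f') \<and> (\<exists>x\<in>{-1..1}. f x \<noteq> 0)"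
proof (intro iffI conjI)
  assume f: "prolate_eigenfunction a c r f"
  then have C2: "C2_I f" and eq: "\<And>x. x \<in> {-1..1} \<Longrightarrow> - prolate_op a c f x = r * f x"
    by (auto simp: prolate_eigenfunction_def)
  have "prolate_ode c a r {-1..1} f (deriv_I f)"
    unfolding prolate_ode_def
  proof (intro exI[of _ "deriv_I (deriv_I f)"] conjI ballI)
    fix x :: real assume x: "x \<in> {-1..1}"
    show "(f has_real_derivative deriv_I f x) (at x within {-1..1})"
      "(deriv_I f has_real_derivative deriv_I (deriv_I f) x) (at x within {-1..1})"
      using C2 x by (auto simp: C2_I_def intro!: differentiable_on_imp_deriv_I)
    show "(1 - x\<^sup>2) * deriv_I (deriv_I f) x = (2 * a + 2) * x * deriv_I f x + (c\<^sup>2 * x\<^sup>2 - r) * f x"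
      using eq[OF x] by (simp add: prolate_op_def algebra_simps)
  qed (use C2 in \<open>simp add: C2_I_def\<close>)
  then show "\<exists>f'. prolate_ode c a r {-1..1} f f'" by blast
  show "\<exists>x\<in>{-1..1}. f x \<noteq> 0" using f by (simp add: prolate_eigenfunction_def)
next
  assume *: "(\<exists>f'. prolate_ode c a r {-1..1} f f') \<and> (\<exists>x\<in>{-1..1}. f x \<noteq> 0)"
  then obtain f' where ode: "prolate_ode c a r {-1..1} f f'" by blast
  obtain f'' where f: "continuous_on {-1..1} f''"
     "\<And>x. x \<in> {-1..1} \<Longrightarrow> (f has_real_derivative f' x) (at x within {-1..1})"
     "\<And>x. x \<in> {-1..1} \<Longrightarrow> (f' has_real_derivative f'' x) (at x within {-1..1})"
     "\<And>x. x \<in> {-1..1} \<Longrightarrow> (1 - x\<^sup>2) * f'' x = (2 * a + 2) * x * f' x + (c\<^sup>2 * x\<^sup>2 - r) * f x"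
    by (rule prolate_odeE[OF ode], rule that)
  have d1: "deriv_I f x = f' x" if "x \<in> {-1..1}" for x
    by (rule deriv_I_eqI[OF that f(2)[OF that]])
  have h2: "(deriv_I f has_real_derivative f'' x) (at x within {-1..1})" if "x \<in> {-1..1}" for x
    using f(3)[OF that] has_field_derivative_transform_within[OF f(3)[OF that] zero_less_one that] d1
    by auto
  have d2: "deriv_I (deriv_I f) x = f'' x" if "x \<in> {-1..1}" for x
    by (rule deriv_I_eqI[OF that h2[OF that]])
  have "C2_I f"
    unfolding C2_I_def
  proof (intro conjI)
    show "f differentiable_on {-1..1}"
      using f(2) unfolding differentiable_on_def real_differentiable_def by blast
    show "deriv_I f differentiable_on {-1..1}"
      using h2 unfolding differentiable_on_def real_differentiable_def by blast
    show "continuous_on {-1..1} (deriv_I (deriv_I f))"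
      using f(1) d2 continuous_on_cong[OF refl, of "{-1..1}" "deriv_I (deriv_I f)" f''] by blast
  qed
  then show "prolate_eigenfunction a c r f"
    using * f(4) d1 d2 unfolding prolate_eigenfunction_def prolate_op_def
    by (auto simp: algebra_simps)
qed

section \<open>Even and odd extensions, simplicity of the eigenvalues\<close>

definition parity_ext :: "real \<Rightarrow> (real \<Rightarrow> real) \<Rightarrow> real \<Rightarrow> real" where
  "parity_ext s u x = (if x \<ge> 0 then u x else s * u (- x))"

text \<open>For \<open>s = 1\<close> the hypotheses say that the derivative vanishes at
  \<open>0\<close>, for \<open>s = - 1\<close> that the value does. By uniqueness the solution then
  has this parity on [-1/4, 1/4], so the extension is given by a single formula on each of the
  overlapping intervals [-1/4, 1] and [-1, 1/4] and its derivatives need no gluing at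
  \<open>0\<close>.\<close>

lemma prolate_ode_parity_ext:
  assumes a: "a \<ge> 0" and s: "s = 1 \<or> s = - 1"
    and u0: "radial c r a 0 = s * radial c r a 0" and u0': "radial' c r a 0 = - s * radial' c r a 0"
  shows "prolate_ode c a r {-1..1} (parity_ext s (radial c r a)) (parity_ext (- s) (radial' c r a))"
proof -
  let ?u = "radial c r a" and ?v = "radial' c r a"
  let ?f = "parity_ext s ?u" and ?f' = "parity_ext (- s) ?v"
  let ?I = "{- (1 / 4)..1 / 4 :: real}"
  have ss: "s * s = 1" using s by auto
  have ode: "prolate_ode c a r {- (1 / 4)..1} ?u ?v" by (rule prolate_ode_radial) (use a in auto)
  obtain w where w: "continuous_on {- (1 / 4)..1} w"
     "\<And>x. x \<in> {- (1 / 4)..1} \<Longrightarrow> (?u has_real_derivative ?v x) (at x within {- (1 / 4)..1})"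
     "\<And>x. x \<in> {- (1 / 4)..1} \<Longrightarrow> (?v has_real_derivative w x) (at x within {- (1 / 4)..1})"
     "\<And>x. x \<in> {- (1 / 4)..1} \<Longrightarrow> (1 - x\<^sup>2) * w x = (2 * a + 2) * x * ?v x + (c\<^sup>2 * x\<^sup>2 - r) * ?u x"
    by (rule prolate_odeE[OF ode], rule that)
  let ?f'' = "parity_ext s w"
  have sym: "?u (- x) = s * ?u x \<and> ?v (- x) = - s * ?v x" if x: "x \<in> ?I" for x
  proof -
    have odeI: "prolate_ode c a r ?I ?u ?v" by (rule prolate_ode_subset[OF ode]) auto
    have "?u x - s * ?u (- x) = 0 \<and> ?v x + s * ?v (- x) = 0"
      using prolate_ode_unique[OF prolate_ode_lincomb[OF odeI prolate_ode_reflect[OF odeI], of 1 "- s"], of 0 x] x u0 u0'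
      by auto
    then have "?u x = s * ?u (- x)" "?v x = - s * ?v (- x)" by auto
    then have "s * ?u x = s * s * ?u (- x)" "- s * ?v x = s * s * ?v (- x)"
      by simp_all
    then show ?thesis by (simp add: ss)
  qed
  have wsym: "w (- x) = s * w x" if x: "x \<in> ?I" for x
  proof -
    have "x\<^sup>2 < 1" using x by (intro square_lt_1) auto
    moreover have "(1 - x\<^sup>2) * w (- x) = s * ((1 - x\<^sup>2) * w x)"
    proof -
      have "(1 - x\<^sup>2) * w (- x) = (1 - (- x)\<^sup>2) * w (- x)" by simp
      also have "\<dots> = (2 * a + 2) * (- x) * ?v (- x) + (c\<^sup>2 * (- x)\<^sup>2 - r) * ?u (- x)"
        by (rule w(4)) (use x in auto)
      also have "\<dots> = s * ((2 * a + 2) * x * ?v x + (c\<^sup>2 * x\<^sup>2 - r) * ?u x)"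
        using sym[OF x] by (simp add: algebra_simps)
      also have "\<dots> = s * ((1 - x\<^sup>2) * w x)" by (subst w(4)) (use x in auto)
      finally show ?thesis .
    qed
    then have "(1 - x\<^sup>2) * (w (- x) - s * w x) = 0" by (simp add: algebra_simps)
    ultimately show ?thesis by auto
  qed
  have right: "?f x = ?u x" "?f' x = ?v x" "?f'' x = w x" if "x \<in> {- (1 / 4)..1}" for x
    using sym[of x] wsym[of x] that ss by (auto simp: parity_ext_def)
  have left: "?f x = s * ?u (- x)" "?f' x = - s * ?v (- x)" "?f'' x = s * w (- x)"
    if "x \<in> {-1..1 / 4}" for x
    using sym[of x] wsym[of x] that ss by (auto simp: parity_ext_def)
  have nhd: "at x within {-1..1} = at x within {- (1 / 4)..1}" if "x > - (1 / 4)" for x :: real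
    by (rule at_within_nhd[of _ "{- (1 / 4)<..}"]) (use that in auto)
  have nhd': "at x within {-1..1} = at x within {-1..1 / 4}" if "x < 1 / 4" for x :: real
    by (rule at_within_nhd[of _ "{..<1 / 4}"]) (use that in auto)
  have transf: "(g has_real_derivative d) (at x within S)"
    if "(f has_real_derivative d) (at x within S)" "x \<in> S" "\<And>y. y \<in> S \<Longrightarrow> g y = f y" for f g :: "real \<Rightarrow> real" and d x S
    by (rule has_field_derivative_transform_within[OF that(1) zero_less_one that(2)]) (use that in auto)
  have refl: "((\<lambda>x. k * g (- x)) has_real_derivative - k * d) (at x within {-1..1 / 4})"
    if "(g has_real_derivative d) (at (- x) within {- (1 / 4)..1})" for g :: "real \<Rightarrow> real" and d k x
  proof -
    have img: "uminus ` {-1..1 / 4 :: real} = {- (1 / 4)..1}" by simp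
    have "(uminus has_real_derivative - 1) (at x within {-1..1 / 4})"
      by (auto intro!: derivative_eq_intros)
    moreover have "(g has_real_derivative d) (at (- x) within uminus ` {-1..1 / 4})"
      using that by (simp only: img)
    ultimately have "((g \<circ> uminus) has_real_derivative d * - 1) (at x within {-1..1 / 4})"
      by (intro DERIV_image_chain)
    from DERIV_cmult[OF this, of k] show ?thesis by (simp add: o_def)
  qed
  show ?thesis
    unfolding prolate_ode_def
  proof (intro exI[of _ ?f''] conjI ballI)
    have "continuous_on ({0..1} \<union> {-1..0}) (\<lambda>x. if x \<ge> 0 then w x else s * w (- x))"
    proof (rule continuous_on_cases)
      show "continuous_on {-1..0} (\<lambda>x. s * w (- x))"
        by (intro continuous_intros continuous_on_compose2[OF w(1)]) auto
      show "continuous_on {0..1} w" by (rule continuous_on_subset[OF w(1)]) auto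
    qed (use wsym[of 0] in auto)
    moreover have "{0..1} \<union> {-1..0} = {-1..1 :: real}" by auto
    ultimately show "continuous_on {-1..1} ?f''" by (simp add: parity_ext_def[abs_def])
    fix x :: real assume x: "x \<in> {-1..1}"
    show "(?f has_real_derivative ?f' x) (at x within {-1..1})"
    proof (cases "x \<ge> 0")
      case True
      have "(?f has_real_derivative ?v x) (at x within {- (1 / 4)..1})"
        by (rule transf[OF w(2) _ right(1)]) (use x True in auto)
      then show ?thesis using nhd[of x] right(2)[of x] x True by auto
    next
      case False
      have "(?f has_real_derivative - s * ?v (- x)) (at x within {-1..1 / 4})"
        by (rule transf[OF refl[OF w(2)] _ left(1)]) (use x False in auto)
      then show ?thesis using nhd'[of x] left(2)[of x] x False by auto
    qed
    show "(?f' has_real_derivative ?f'' x) (at x within {-1..1})"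
    proof (cases "x \<ge> 0")
      case True
      have "(?f' has_real_derivative w x) (at x within {- (1 / 4)..1})"
        by (rule transf[OF w(3) _ right(2)]) (use x True in auto)
      then show ?thesis using nhd[of x] right(3)[of x] x True by auto
    next
      case False
      have "(?f' has_real_derivative - (- s) * w (- x)) (at x within {-1..1 / 4})"
        by (rule transf[OF refl[OF w(3)] _ left(2)]) (use x False in auto)
      then show ?thesis using nhd'[of x] left(3)[of x] x False by auto
    qed
    show "(1 - x\<^sup>2) * ?f'' x = (2 * a + 2) * x * ?f' x + (c\<^sup>2 * x\<^sup>2 - r) * ?f x"
    proof (cases "x \<ge> 0")
      case True
      then show ?thesis using w(4)[of x] x by (simp add: parity_ext_def)
    next
      case False
      then have "(1 - x\<^sup>2) * ?f'' x = s * ((1 - (- x)\<^sup>2) * w (- x))"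
        by (simp add: parity_ext_def)
      also have "\<dots> = (2 * a + 2) * x * ?f' x + (c\<^sup>2 * x\<^sup>2 - r) * ?f x"
        using False x by (subst w(4)) (auto simp: parity_ext_def algebra_simps)
      finally show ?thesis .
    qed
  qed
qed

text \<open>Each half carries a one-dimensional space of regular solutions. The last two equations
  match value and slope at \<open>0\<close>; a nonzero pair \<open>k\<close>, \<open>l\<close>
  forces one of the two data of \<open>radial\<close> at \<open>0\<close> to vanish.\<close>

lemma prolate_ode_two_sided_form:
  assumes f: "prolate_ode c a r {-1..1} f f'" and a: "a \<ge> 0"
  obtains k l where "\<And>x. x \<in> {0..1} \<Longrightarrow> f x = k * radial c r a x"
    "\<And>x. x \<in> {0..1} \<Longrightarrow> f (- x) = l * radial c r a x"
    "(k - l) * radial c r a 0 = 0" "(k + l) * radial' c r a 0 = 0"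
proof -
  have sub: "{0..1} \<subseteq> {-1..1 :: real}" by auto
  from prolate_ode_proportional[OF prolate_ode_subset[OF f sub] a]
  obtain k where k: "\<forall>x\<in>{0..1}. f x = k * radial c r a x" "f' 0 = k * radial' c r a 0" by blast
  from prolate_ode_proportional[OF prolate_ode_subset[OF prolate_ode_reflect[OF f] sub] a]
  obtain l where l: "\<forall>x\<in>{0..1}. f (- x) = l * radial c r a x" "- f' 0 = l * radial' c r a 0"
    by auto
  have "f 0 = k * radial c r a 0" "f 0 = l * radial c r a 0" using k(1) l(1) by force+
  then show ?thesis using k l by (intro that[of k l]) (auto simp: algebra_simps)
qed

lemma sin_cos_multiple_pi_half:
  "even n \<Longrightarrow> sin (real n * (pi / 2)) = 0" "odd n \<Longrightarrow> cos (real n * (pi / 2)) = 0"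
proof -
  show "sin (real n * (pi / 2)) = 0" if "even n"
    using that by (auto elim!: evenE)
  show "cos (real n * (pi / 2)) = 0" if odd: "odd n"
  proof -
    obtain m where "n = 2 * m + 1" by (rule oddE[OF odd])
    then have eq: "real n * (pi / 2) = real m * pi + pi / 2" by (simp add: algebra_simps)
    show ?thesis unfolding eq cos_add by simp
  qed
qed

lemma radial_parity:
  assumes \<theta>: "prufer_angle c \<theta>" and a: "a \<ge> 0" and n: "\<theta> r a = real n * (pi / 2)"
  shows "radial c r a 0 = (- 1) ^ n * radial c r a 0" "radial' c r a 0 = - ((- 1) ^ n) * radial' c r a 0"
    and "even n \<Longrightarrow> radial c r a 0 \<noteq> 0" "odd n \<Longrightarrow> radial' c r a 0 \<noteq> 0"
proof -
  obtain \<rho> where \<rho>: "radial c r a 0 = \<rho> * cos (\<theta> r a)" "radial' c r a 0 = \<rho> * sin (\<theta> r a)"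
    using \<theta> a unfolding prufer_angle_def by blast
  have nd: "radial c r a 0 \<noteq> 0 \<or> radial' c r a 0 \<noteq> 0" using a by (intro radial_nondegenerate) auto
  show "radial c r a 0 = (- 1) ^ n * radial c r a 0" "radial' c r a 0 = - ((- 1) ^ n) * radial' c r a 0"
    "even n \<Longrightarrow> radial c r a 0 \<noteq> 0" "odd n \<Longrightarrow> radial' c r a 0 \<noteq> 0"
    using \<rho> nd sin_cos_multiple_pi_half[of n] unfolding n by (cases "even n"; simp)+
qed

text \<open>The GPSWF of index \<open>n\<close> up to a scalar, if \<open>r\<close> is its
  eigenvalue; unlike the L2 normalisation this one has a definite sign.\<close>

definition gpswf_radial :: "real \<Rightarrow> real \<Rightarrow> nat \<Rightarrow> real \<Rightarrow> real \<Rightarrow> real" where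
  "gpswf_radial c a n r = parity_ext ((- 1) ^ n) (radial c r a)"

lemma prolate_ode_gpswf_radial:
  assumes "prufer_angle c \<theta>" "a \<ge> 0" "\<theta> r a = real n * (pi / 2)"
  shows "prolate_ode c a r {-1..1} (gpswf_radial c a n r) (parity_ext (- ((- 1) ^ n)) (radial' c r a))"
  unfolding gpswf_radial_def
  by (rule prolate_ode_parity_ext) (use radial_parity[OF assms] assms in \<open>auto simp: uminus_power_if\<close>)

lemma prolate_ode_multiple:
  assumes "prufer_angle c \<theta>" "a \<ge> 0" "\<theta> r a = real n * (pi / 2)"
    and f: "prolate_ode c a r {-1..1} f f'"
  obtains k where "\<And>x. x \<in> {-1..1} \<Longrightarrow> f x = k * gpswf_radial c a n r x"
proof -
  obtain k l where kl: "\<And>x. x \<in> {0..1} \<Longrightarrow> f x = k * radial c r a x"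
    "\<And>x. x \<in> {0..1} \<Longrightarrow> f (- x) = l * radial c r a x"
    "(k - l) * radial c r a 0 = 0" "(k + l) * radial' c r a 0 = 0"
    by (rule prolate_ode_two_sided_form[OF f assms(2)], rule that)
  have l: "l = k * (- 1) ^ n"
    using kl(3,4) radial_parity(3,4)[OF assms(1-3)] by (cases "even n") auto
  show ?thesis
  proof (rule that[of k])
    fix x :: real assume x: "x \<in> {-1..1}"
    show "f x = k * gpswf_radial c a n r x"
      using kl(1)[of x] kl(2)[of "- x"] x l by (auto simp: gpswf_radial_def parity_ext_def)
  qed
qed

text \<open>Matching at \<open>0\<close> is possible iff the value or the slope vanishes there, that
  is, iff \<open>sin (2 * \<theta>) = 0\<close>.\<close>

lemma eigenvalue_iff_prufer_angle:
  assumes \<theta>: "prufer_angle c \<theta>" and a: "a \<ge> 0"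
  shows "(\<exists>f. prolate_eigenfunction a c r f) \<longleftrightarrow> (\<exists>n. \<theta> r a = real n * (pi / 2))"
proof
  assume "\<exists>f. prolate_eigenfunction a c r f"
  then obtain f f' x where f: "prolate_ode c a r {-1..1} f f'" and x: "x \<in> {-1..1}" "f x \<noteq> 0"
    unfolding prolate_eigenfunction_iff by blast
  obtain k l where kl: "\<And>x. x \<in> {0..1} \<Longrightarrow> f x = k * radial c r a x"
    "\<And>x. x \<in> {0..1} \<Longrightarrow> f (- x) = l * radial c r a x"
    "(k - l) * radial c r a 0 = 0" "(k + l) * radial' c r a 0 = 0"
    by (rule prolate_ode_two_sided_form[OF f a], rule that)
  have "k \<noteq> 0 \<or> l \<noteq> 0"
    using kl(1)[of x] kl(2)[of "- x"] x by (cases "x \<ge> 0") auto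
  then have z: "radial c r a 0 = 0 \<or> radial' c r a 0 = 0" using kl(3,4) by auto
  obtain \<rho> where \<rho>: "\<rho> > 0" "radial c r a 0 = \<rho> * cos (\<theta> r a)" "radial' c r a 0 = \<rho> * sin (\<theta> r a)"
    using \<theta> a unfolding prufer_angle_def by blast
  have "sin (2 * \<theta> r a) = 0" using z \<rho> by (auto simp: sin_double)
  then obtain i :: int where i: "2 * \<theta> r a = of_int i * pi" using sin_zero_iff_int2 by blast
  \<comment> \<open>The angle always exceeds -\<pi>/2, so negative multiples do not occur and the
    count starts at 0.\<close>
  have "of_int i * pi > - 1 * pi" using i prufer_angle_gt[OF \<theta> a, of r] by simp
  then have "i \<ge> 0" by (subst (asm) mult_less_cancel_right) auto
  then have "\<theta> r a = real (nat i) * (pi / 2)" using i by simp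
  then show "\<exists>n. \<theta> r a = real n * (pi / 2)" by blast
next
  assume "\<exists>n. \<theta> r a = real n * (pi / 2)"
  then obtain n where n: "\<theta> r a = real n * (pi / 2)" by blast
  have "gpswf_radial c a n r 1 \<noteq> 0" by (simp add: gpswf_radial_def parity_ext_def)
  then have "\<exists>x\<in>{-1..1}. gpswf_radial c a n r x \<noteq> 0" by (rule bexI) auto
  then show "\<exists>f. prolate_eigenfunction a c r f"
    using prolate_ode_gpswf_radial[OF \<theta> a n] unfolding prolate_eigenfunction_iff by blast
qed

section \<open>Index of an eigenvalue and its continuation in the exponent\<close>

lemma strict_mono_initial_range_id:
  fixes k :: "nat \<Rightarrow> nat"
  assumes k: "strict_mono k" and closed: "\<And>m n. m \<le> k n \<Longrightarrow> m \<in> range k"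
  shows "k n = n"
proof (induction n rule: less_induct)
  case (less n)
  have "n \<le> k n" using k by (rule strict_mono_imp_increasing)
  then obtain j where j: "n = k j" using closed by blast
  have "\<not> j < n" using less.IH[of j] j by auto
  moreover have "j \<le> n" using strict_mono_imp_increasing[OF k, of j] j by simp
  ultimately show ?case using j by simp
qed

text \<open>The multiples of \<pi>/2 attained along \<open>X\<close> increase strictly with the
  index and leave no gap, since every smaller multiple is attained too and then belongs to an
  eigenvalue in the range of \<open>X\<close>.\<close>

lemma gpswf_family_prufer_angle:
  assumes fam: "gpswf_family a c X \<psi>" and \<theta>: "prufer_angle c \<theta>" and a: "a \<ge> 0"
  shows "\<theta> (X n) a = real n * (pi / 2)"
proof -
  have X: "strict_mono X" and range: "range X = {r. \<exists>n. \<theta> r a = real n * (pi / 2)}"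
    using fam unfolding gpswf_family_def eigenvalue_iff_prufer_angle[OF \<theta> a] by auto
  have "\<forall>n. \<exists>m. \<theta> (X n) a = real m * (pi / 2)" using range by blast
  then obtain k where k: "\<And>n. \<theta> (X n) a = real (k n) * (pi / 2)" by metis
  have "strict_mono k"
  proof (rule strict_monoI)
    fix m n :: nat assume "m < n"
    then have "\<theta> (X m) a < \<theta> (X n) a"
      using X by (intro prufer_angle_strict_mono[OF \<theta> a]) (simp add: strict_mono_def)
    then show "k m < k n" by (simp add: k)
  qed
  moreover have "m \<in> range k" if "m \<le> k n" for m n
  proof -
    have "real m * (pi / 2) \<le> \<theta> (X n) a" unfolding k using that by (intro mult_right_mono) auto
    then obtain r where r: "\<theta> r a = real m * (pi / 2)"
      using prufer_angle_intermediate[OF \<theta> a, of "real m * (pi / 2)" "X n"] by auto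
    then obtain j where "r = X j" using range by blast
    then have "m = k j" using r k[of j] by simp
    then show ?thesis by blast
  qed
  ultimately have "k n = n" by (rule strict_mono_initial_range_id)
  then show ?thesis by (simp add: k)
qed

text \<open>At a smaller exponent \<open>t\<close> the parameter \<open>s + 2 * (a - t)\<close>
  already has angle at least \<open>v\<close>, so the value is attained. Continuity: \<theta> lies
  below \<open>v\<close> at \<open>\<kappa> x - e\<close> and above it at
  \<open>\<kappa> x + e\<close>; this persists for nearby exponents, and monotonicity in
  \<open>r\<close> traps the root.\<close>

lemma eigenvalue_branch:
  assumes \<theta>: "prufer_angle c \<theta>" and ab: "0 \<le> b" "b \<le> a" and v: "v \<ge> 0" "\<theta> s a = v"
  obtains \<kappa> where "continuous_on {b..a} \<kappa>" "\<And>t. t \<in> {b..a} \<Longrightarrow> \<theta> (\<kappa> t) t = v"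
proof -
  have "\<exists>r. \<theta> r t = v" if "t \<in> {b..a}" for t
  proof -
    have "v \<le> \<theta> (s + 2 * (a - t)) t"
      using prufer_angle_decrease_exponent[OF \<theta>, of t a s] that ab v by auto
    then show ?thesis
      using prufer_angle_intermediate[OF \<theta>, of t v] that ab v(1) by (metis atLeastAtMost_iff order_trans)
  qed
  then obtain \<kappa> where \<kappa>: "\<And>t. t \<in> {b..a} \<Longrightarrow> \<theta> (\<kappa> t) t = v" by metis
  have cont\<theta>: "continuous_on {b..a} (\<theta> r)" for r
  proof -
    have "continuous_on (UNIV \<times> {0..}) (\<lambda>p. \<theta> (fst p) (snd p))"
      using \<theta> by (simp add: prufer_angle_def)
    moreover have "continuous_on {b..a} (\<lambda>t. (r, t))" by (intro continuous_intros)
    ultimately have "continuous_on {b..a} (\<lambda>t. \<theta> (fst (r, t)) (snd (r, t)))"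
      by (rule continuous_on_compose2) (use ab in auto)
    then show ?thesis by simp
  qed
  have "continuous_on {b..a} \<kappa>"
    unfolding continuous_on_iff dist_real_def
  proof (intro ballI allI impI)
    fix x e :: real assume x: "x \<in> {b..a}" and e: "e > 0"
    have x0: "x \<ge> 0" using x ab by auto
    define l where "l = \<kappa> x - e"
    define u where "u = \<kappa> x + e"
    have l: "\<theta> l x < v" and u: "v < \<theta> u x"
      using prufer_angle_less_iff[OF \<theta> x0] e \<kappa>[OF x, symmetric] by (auto simp: l_def u_def)
    obtain d1 where d1: "d1 > 0" "\<And>t. t \<in> {b..a} \<Longrightarrow> \<bar>t - x\<bar> < d1 \<Longrightarrow> \<bar>\<theta> l t - \<theta> l x\<bar> < v - \<theta> l x"
      using cont\<theta>[of l] x l unfolding continuous_on_iff dist_real_def by (metis diff_gt_0_iff_gt)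
    obtain d2 where d2: "d2 > 0" "\<And>t. t \<in> {b..a} \<Longrightarrow> \<bar>t - x\<bar> < d2 \<Longrightarrow> \<bar>\<theta> u t - \<theta> u x\<bar> < \<theta> u x - v"
      using cont\<theta>[of u] x u unfolding continuous_on_iff dist_real_def by (metis diff_gt_0_iff_gt)
    have "\<bar>\<kappa> t - \<kappa> x\<bar> < e" if t: "t \<in> {b..a}" "\<bar>t - x\<bar> < min d1 d2" for t
    proof -
      have t0: "t \<ge> 0" using t ab by auto
      have "\<theta> l t < \<theta> (\<kappa> t) t" using d1(2)[of t] t \<kappa>[OF t(1)] by auto
      then have "l < \<kappa> t" using prufer_angle_less_iff[OF \<theta> t0] by simp
      moreover have "\<theta> (\<kappa> t) t < \<theta> u t" using d2(2)[of t] t \<kappa>[OF t(1)] by auto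
      then have "\<kappa> t < u" using prufer_angle_less_iff[OF \<theta> t0] by simp
      ultimately show ?thesis by (auto simp: l_def u_def)
    qed
    then show "\<exists>d>0. \<forall>t\<in>{b..a}. \<bar>t - x\<bar> < d \<longrightarrow> \<bar>\<kappa> t - \<kappa> x\<bar> < e"
      using d1(1) d2(1) by (intro exI[of _ "min d1 d2"]) auto
  qed
  then show ?thesis using \<kappa> by (rule that)
qed

section \<open>Fourier eigenvalues\<close>

text \<open>Applied with \<open>K = cos\<close> and \<open>K = sin\<close>, the real and imaginary parts of the Fourier kernel. The
  differential expression in \<open>x\<close> applied to \<open>K (c * x * y)\<close> is symmetric in \<open>x\<close> and \<open>y\<close>, so it can be moved
  onto \<open>f\<close> by partial integration.\<close>
lemma prolate_ode_integral_transform: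
  assumes f: "prolate_ode c a r {-1..1} f f'" and a: "a \<ge> 0"
    and K: "\<And>t. (K has_real_derivative K' t) (at t)" and K': "\<And>t. (K' has_real_derivative - K t) (at t)"
  shows "prolate_ode c a r {-1..1}
      (\<lambda>x. integral {-1..1} (\<lambda>y. K (c * x * y) * (f y * gweight a y)))
      (\<lambda>x. integral {-1..1} (\<lambda>y. c * y * K' (c * x * y) * (f y * gweight a y)))"
proof -
  let ?w = "gweight a"
  have cK: "continuous_on S K" and cK': "continuous_on S K'" for S
    by (rule continuous_at_imp_continuous_on; use K K' in \<open>blast intro: DERIV_isCont\<close>)+
  have ccK: "continuous_on S (\<lambda>z. K (g z))" and ccK': "continuous_on S (\<lambda>z. K' (g z))"
    if "continuous_on S g" for S and g :: "'a :: topological_space \<Rightarrow> real"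
    by (rule continuous_on_compose2[OF cK that subset_UNIV] continuous_on_compose2[OF cK' that subset_UNIV])+
  note cf = prolate_ode_continuous[OF f] continuous_on_gweight[OF a]
  have csnd: "continuous_on ({-1..1} \<times> {-1..1}) (\<lambda>z :: real \<times> real. f (snd z))"
     "continuous_on ({-1..1} \<times> {-1..1}) (\<lambda>z :: real \<times> real. ?w (snd z))"
    by (rule continuous_on_compose2[OF cf(1)] continuous_on_compose2[OF cf(3)]; auto intro!: continuous_intros)+
  obtain f'' where f'': "continuous_on {-1..1} f''"
     "\<And>x. x \<in> {-1..1} \<Longrightarrow> (f has_real_derivative f' x) (at x within {-1..1})"
     "\<And>x. x \<in> {-1..1} \<Longrightarrow> (f' has_real_derivative f'' x) (at x within {-1..1})"
     "\<And>x. x \<in> {-1..1} \<Longrightarrow> (1 - x\<^sup>2) * f'' x = (2 * a + 2) * x * f' x + (c\<^sup>2 * x\<^sup>2 - r) * f x"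
    by (rule prolate_odeE[OF f], rule that)
  define h where "h x = integral {-1..1} (\<lambda>y. K (c * x * y) * (f y * ?w y))" for x
  define h' where "h' x = integral {-1..1} (\<lambda>y. c * y * K' (c * x * y) * (f y * ?w y))" for x
  define h'' where "h'' x = integral {-1..1} (\<lambda>y. - (c\<^sup>2 * y\<^sup>2) * K (c * x * y) * (f y * ?w y))" for x
  have i0: "(\<lambda>y. K (c * x * y) * (f y * ?w y)) integrable_on {-1..1}"
    and i1: "(\<lambda>y. c * y * K' (c * x * y) * (f y * ?w y)) integrable_on {-1..1}"
    and i2: "(\<lambda>y. - (c\<^sup>2 * y\<^sup>2) * K (c * x * y) * (f y * ?w y)) integrable_on {-1..1}" for x
    by (intro integrable_continuous_real continuous_intros ccK ccK' cf)+
  have c1: "continuous_on ({-1..1} \<times> cbox (-1) 1) (\<lambda>(x, y). c * y * K' (c * x * y) * (f y * ?w y))"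
    and c2: "continuous_on ({-1..1} \<times> cbox (-1) 1) (\<lambda>(x, y). - (c\<^sup>2 * y\<^sup>2) * K (c * x * y) * (f y * ?w y))"
    unfolding split_beta box_real by (intro continuous_intros ccK ccK' csnd)+
  have dK: "((\<lambda>x. K (c * x * y)) has_real_derivative K' (c * x * y) * (c * y)) (at x within S)"
    and dK': "((\<lambda>x. K' (c * x * y)) has_real_derivative - K (c * x * y) * (c * y)) (at x within S)" for x y S
    by (rule DERIV_chain2[OF K] DERIV_chain2[OF K'], (auto intro!: derivative_eq_intros)[1])+
  show ?thesis
    unfolding prolate_ode_def h_def[symmetric] h'_def[symmetric]
  proof (intro exI[of _ h''] conjI ballI)
    have "continuous_on {-1..1} (\<lambda>x. integral (cbox (-1) 1) (\<lambda>y. - (c\<^sup>2 * y\<^sup>2) * K (c * x * y) * (f y * ?w y)))"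
      by (rule integral_continuous_on_param[OF c2])
    then show "continuous_on {-1..1} h''" by (simp add: h''_def[abs_def])
    fix x :: real assume x: "x \<in> {-1..1}"
    have "((\<lambda>x. integral (cbox (-1) 1) (\<lambda>y. K (c * x * y) * (f y * ?w y))) has_real_derivative
        integral (cbox (-1) 1) (\<lambda>y. c * y * K' (c * x * y) * (f y * ?w y))) (at x within {-1..1})"
    proof (rule leibniz_rule_field_derivative)
      fix x y :: real
      show "((\<lambda>x. K (c * x * y) * (f y * ?w y)) has_real_derivative c * y * K' (c * x * y) * (f y * ?w y))
          (at x within {-1..1})"
        by (rule DERIV_cong[OF DERIV_cmult_right[OF dK]]) (simp add: mult_ac)
    qed (use i0 c1 x in auto)
    then show "(h has_real_derivative h' x) (at x within {-1..1})"
      by (simp add: h_def[abs_def] h'_def)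
    have "((\<lambda>x. integral (cbox (-1) 1) (\<lambda>y. c * y * K' (c * x * y) * (f y * ?w y))) has_real_derivative
        integral (cbox (-1) 1) (\<lambda>y. - (c\<^sup>2 * y\<^sup>2) * K (c * x * y) * (f y * ?w y))) (at x within {-1..1})"
    proof (rule leibniz_rule_field_derivative)
      fix x y :: real
      show "((\<lambda>x. c * y * K' (c * x * y) * (f y * ?w y)) has_real_derivative
          - (c\<^sup>2 * y\<^sup>2) * K (c * x * y) * (f y * ?w y)) (at x within {-1..1})"
        by (rule DERIV_cong[OF DERIV_cmult_right[OF DERIV_cmult[OF dK']]]) (simp add: mult_ac power2_eq_square)
    qed (use i1 c2 x in auto)
    then show "(h' has_real_derivative h'' x) (at x within {-1..1})"
      by (simp add: h'_def[abs_def] h''_def)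
    \<comment> \<open>The weighted Wronskian in \<open>y\<close> of the kernel and \<open>f\<close>.
      It vanishes at both endpoints, and its derivative \<open>Q\<close> is the integrand of the
      equation to be shown for the transform.\<close>
    define P where "P y = ((1 - y\<^sup>2) * ?w y) * (c * x * K' (c * x * y) * f y - K (c * x * y) * f' y)" for y
    define Q where "Q y = (1 - x\<^sup>2) * (- (c\<^sup>2 * y\<^sup>2) * K (c * x * y) * (f y * ?w y))
        - (2 * a + 2) * x * (c * y * K' (c * x * y) * (f y * ?w y))
        - (c\<^sup>2 * x\<^sup>2 - r) * (K (c * x * y) * (f y * ?w y))" for y
    have "(Q has_integral (P 1 - P (-1))) {-1..1}"
    proof (rule fundamental_theorem_of_calculus_interior)
      show "continuous_on {-1..1} P" unfolding P_def by (intro continuous_intros ccK ccK' cf)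
    next
      fix y :: real assume y: "y \<in> {-1<..<1}"
      then have yI: "y \<in> {-1..1}" and at: "at y within {-1..1} = at y"
        by (auto intro: at_within_Icc_at)
      note d = f''(2,3)[OF yI, unfolded at]
      let ?K = "K (c * x * y)" and ?K' = "K' (c * x * y)"
      have dKy: "((\<lambda>y. K (c * x * y)) has_real_derivative ?K' * (c * x)) (at y)"
        and dKy': "((\<lambda>y. K' (c * x * y)) has_real_derivative - ?K * (c * x)) (at y)"
        by (rule DERIV_chain2[OF K] DERIV_chain2[OF K'], (auto intro!: derivative_eq_intros)[1])+
      have wr: "((\<lambda>y. c * x * K' (c * x * y) * f y - K (c * x * y) * f' y) has_real_derivative
          - (c\<^sup>2 * x\<^sup>2) * ?K * f y - ?K * f'' y) (at y)"
        by (rule DERIV_cong[OF DERIV_diff[OF DERIV_mult[OF DERIV_cmult[OF dKy'] d(1)] DERIV_mult[OF dKy d(2)]]])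
           (simp add: algebra_simps power2_eq_square)
      have fl: "((\<lambda>y. (1 - y\<^sup>2) * ?w y) has_real_derivative - (2 * a + 2) * y * ?w y) (at y)"
        by (rule gweight_flux_deriv) (use y in auto)
      have "(P has_real_derivative
          - (2 * a + 2) * y * ?w y * (c * x * ?K' * f y - ?K * f' y)
          + (- (c\<^sup>2 * x\<^sup>2) * ?K * f y - ?K * f'' y) * ((1 - y\<^sup>2) * ?w y)) (at y)"
        unfolding P_def[abs_def] by (rule DERIV_mult[OF fl wr])
      moreover have "- (2 * a + 2) * y * ?w y * (c * x * ?K' * f y - ?K * f' y)
          + (- (c\<^sup>2 * x\<^sup>2) * ?K * f y - ?K * f'' y) * ((1 - y\<^sup>2) * ?w y)
        = ?w y * (- (2 * a + 2) * y * (c * x * ?K' * f y - ?K * f' y)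
          - (1 - y\<^sup>2) * (c\<^sup>2 * x\<^sup>2) * ?K * f y - ?K * ((1 - y\<^sup>2) * f'' y))"
        by (simp add: algebra_simps)
      moreover have "\<dots> = Q y"
        unfolding f''(4)[OF yI] Q_def by (simp add: algebra_simps)
      ultimately show "(P has_vector_derivative Q y) (at y)"
        by (simp add: has_real_derivative_iff_has_vector_derivative)
    qed simp
    then have "(Q has_integral 0) {-1..1}" by (simp add: P_def)
    moreover have "(Q has_integral (1 - x\<^sup>2) * h'' x - (2 * a + 2) * x * h' x - (c\<^sup>2 * x\<^sup>2 - r) * h x) {-1..1}"
      unfolding Q_def[abs_def] h_def h'_def h''_def
      by (intro has_integral_diff has_integral_mult_right integrable_integral i0 i1 i2)
    ultimately have "(1 - x\<^sup>2) * h'' x - (2 * a + 2) * x * h' x - (c\<^sup>2 * x\<^sup>2 - r) * h x = 0"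
      by (rule has_integral_unique[symmetric])
    then show "(1 - x\<^sup>2) * h'' x = (2 * a + 2) * x * h' x + (c\<^sup>2 * x\<^sup>2 - r) * h x" by simp
  qed
qed

text \<open>With \<open>K\<close> equal to \<open>cos\<close> or \<open>sin\<close>, the two values
  of \<open>k\<close> are the real and the imaginary part of the Fourier eigenvalue.\<close>

definition transform_eigenvalue :: "(real \<Rightarrow> real) \<Rightarrow> real \<Rightarrow> real \<Rightarrow> (real \<Rightarrow> real) \<Rightarrow> real \<Rightarrow> bool" where
  "transform_eigenvalue K c a f k \<longleftrightarrow>
     (\<forall>x\<in>{-1..1}. integral {-1..1} (\<lambda>y. K (c * x * y) * (f y * gweight a y)) = k * f x)"

text \<open>The transform is again a solution with the same \<open>r\<close>, and the solutions on
  the whole interval form a line.\<close>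

lemma transform_eigenvalue_exists:
  assumes "prufer_angle c \<theta>" "a \<ge> 0" "\<theta> r a = real n * (pi / 2)"
    and "\<And>t. (K has_real_derivative K' t) (at t)" "\<And>t. (K' has_real_derivative - K t) (at t)"
  obtains k where "transform_eigenvalue K c a (gpswf_radial c a n r) k"
  using prolate_ode_multiple[OF assms(1-3)
      prolate_ode_integral_transform[OF prolate_ode_gpswf_radial[OF assms(1-3)] assms(2) assms(4,5)]]
  unfolding transform_eigenvalue_def by metis

lemma transform_eigenvalue_swap:
  assumes f: "transform_eigenvalue K c a f k" "continuous_on {-1..1} f" "a \<ge> 0"
    and g: "transform_eigenvalue K c b g l" "continuous_on {-1..1} g" "b \<ge> 0"
    and K: "continuous_on UNIV K"
  shows "k * integral {-1..1} (\<lambda>x. f x * g x * gweight b x) = l * integral {-1..1} (\<lambda>x. f x * g x * gweight a x)"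
proof -
  let ?F = "\<lambda>x y. K (c * x * y) * (f y * gweight a y) * (g x * gweight b x)"
  have c: "continuous_on {-1..1} (\<lambda>y. f y * gweight a y)" "continuous_on {-1..1} (\<lambda>y. g y * gweight b y)"
    by (intro continuous_intros f g continuous_on_gweight)+
  have "continuous_on (cbox (-1, -1) (1, 1)) (\<lambda>z. K (c * fst z * snd z) * (f (snd z) * gweight a (snd z))
      * (g (fst z) * gweight b (fst z)))"
    by (intro continuous_intros continuous_on_compose2[OF K] continuous_on_compose2[OF c(1), of _ snd]
          continuous_on_compose2[OF c(2), of _ fst])
       (auto simp: cbox_Pair_eq)
  then have cF: "continuous_on (cbox (-1, -1) (1, 1)) (\<lambda>(x, y). ?F x y)"
    by (simp add: split_beta)
  have "integral {-1..1} (\<lambda>x. k * (f x * g x * gweight b x))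
      = integral {-1..1} (\<lambda>x. integral {-1..1} (\<lambda>y. ?F x y))"
  proof (intro integral_cong)
    fix x :: real assume x: "x \<in> {-1..1}"
    have "integral {-1..1} (?F x) = k * f x * (g x * gweight b x)"
      using f(1) x by (simp add: transform_eigenvalue_def)
    then show "k * (f x * g x * gweight b x) = integral {-1..1} (?F x)" by (simp add: mult_ac)
  qed
  also have "\<dots> = integral {-1..1} (\<lambda>y. integral {-1..1} (\<lambda>x. ?F x y))"
    using integral_swap_continuous[OF cF] by simp
  also have "\<dots> = integral {-1..1} (\<lambda>y. l * (f y * g y * gweight a y))"
  proof (intro integral_cong)
    fix y :: real assume y: "y \<in> {-1..1}"
    have "integral {-1..1} (\<lambda>x. ?F x y)
        = integral {-1..1} (\<lambda>x. f y * gweight a y * (K (c * y * x) * (g x * gweight b x)))"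
      by (intro integral_cong) (simp add: mult_ac)
    also have "\<dots> = f y * gweight a y * (l * g y)"
      using g(1) y by (simp add: transform_eigenvalue_def)
    finally show "integral {-1..1} (\<lambda>x. ?F x y) = l * (f y * g y * gweight a y)" by (simp add: mult_ac)
  qed
  finally show ?thesis by simp
qed

section \<open>Comparison of the weighted integrals\<close>

text \<open>The inequality \<open>lo < hi\<close> is strict because \<open>0 powr 0 = 0\<close>
  would spoil the endpoints for \<open>lo = hi = 0\<close>.\<close>

lemma gweight_factor:
  assumes "0 \<le> lo" "lo < hi" "- 1 \<le> x" "x \<le> 1"
  shows "gweight hi x = gweight lo x * (1 - x\<^sup>2) powr (hi - lo)"
  using assms by (auto simp: gweight_def powr_add[symmetric])

lemma gweight_antimono:
  assumes "0 \<le> lo" "lo \<le> hi" "- 1 \<le> x" "x \<le> 1"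
  shows "gweight hi x \<le> gweight lo x"
proof (cases "lo = hi")
  case False
  have "(1 - x\<^sup>2) powr (hi - lo) \<le> 1"
    using square_le_1[of x] assms by (intro powr_le1) auto
  then have "gweight lo x * (1 - x\<^sup>2) powr (hi - lo) \<le> gweight lo x * 1"
    by (intro mult_left_mono) auto
  then show ?thesis using gweight_factor[of lo hi x] assms False by simp
qed simp

text \<open>Passing from exponent \<open>hi\<close> to \<open>lo\<close> adds weight; relative to its size at \<open>\<bar>x\<bar> = 1 - h\<close>, the added
  weight is large near the endpoints, where \<open>g\<close> is positive, and small elsewhere.\<close>
lemma integral_gweight_compare:
  assumes g: "continuous_on {-1..1} g" and lohi: "0 \<le> lo" "lo < hi" "hi \<le> A" and h: "0 < h" "h < 1"
    and \<kappa>: "\<kappa> > 0" and \<epsilon>: "\<epsilon> \<ge> 0"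
    and glow: "\<And>x. x \<in> {-1..1} \<Longrightarrow> g x \<ge> - \<epsilon>" and gend: "\<And>x. x \<in> {-1..1} \<Longrightarrow> \<bar>x\<bar> \<ge> 1 - h \<Longrightarrow> g x \<ge> \<kappa>"
    and small: "2 * \<epsilon> < \<kappa> * integral {-1..1} (\<lambda>x. gweight A x * max 0 (\<bar>x\<bar> - (1 - h)))"
  shows "0 < integral {-1..1} (\<lambda>x. g x * gweight hi x)"
    and "integral {-1..1} (\<lambda>x. g x * gweight hi x) \<le> integral {-1..1} (\<lambda>x. g x * gweight lo x)"
proof -
  \<comment> \<open>A continuous bump supported near the endpoints; the largest exponent
    \<open>A\<close> puts it below both weights at once.\<close>
  define \<phi> where "\<phi> x = gweight A x * max 0 (\<bar>x\<bar> - (1 - h))" for x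
  \<comment> \<open>\<open>D\<close> is 1 minus the ratio of the two weights at
    \<open>\<bar>x\<bar> = 1 - h\<close>. The ratio decreases in \<open>\<bar>x\<bar>\<close>, so
    \<open>D\<close> bounds the added weight from above inside, and relative to the weight
    \<open>lo\<close> from below outside.\<close>
  define D where "D = 1 - (1 - (1 - h)\<^sup>2) powr (hi - lo)"
  have sq: "(1 - h)\<^sup>2 \<le> 1" using h by (intro square_le_1) auto
  have D: "0 \<le> D" "D \<le> 1"
    using sq lohi by (auto simp: D_def intro!: powr_le1)
  have diff: "gweight lo x - gweight hi x = gweight lo x * (1 - (1 - x\<^sup>2) powr (hi - lo))"
    if "x \<in> {-1..1}" for x
    using gweight_factor[of lo hi x] lohi that by (simp add: algebra_simps)
  have inner: "gweight lo x - gweight hi x \<le> D" if x: "x \<in> {-1..1}" "\<bar>x\<bar> < 1 - h" for x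
  proof -
    have "x\<^sup>2 \<le> (1 - h)\<^sup>2" using x h by (simp add: abs_le_square_iff[symmetric])
    then have "(1 - (1 - h)\<^sup>2) powr (hi - lo) \<le> (1 - x\<^sup>2) powr (hi - lo)"
      using sq lohi by (intro powr_mono2) auto
    then have 1: "1 - (1 - x\<^sup>2) powr (hi - lo) \<le> D" unfolding D_def by (rule diff_left_mono)
    have "gweight lo x * (1 - (1 - x\<^sup>2) powr (hi - lo)) \<le> 1 * (1 - (1 - x\<^sup>2) powr (hi - lo))"
      using x lohi square_le_1[of x] by (intro mult_right_mono gweight_le_1) (auto intro!: powr_le1)
    also have "\<dots> \<le> D" using 1 by (simp only: mult_1_left)
    finally show ?thesis unfolding diff[OF x(1)] .
  qed
  have outer: "gweight lo x * D \<le> gweight lo x - gweight hi x" if x: "x \<in> {-1..1}" "\<bar>x\<bar> \<ge> 1 - h" for x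
  proof -
    have "(1 - h)\<^sup>2 \<le> x\<^sup>2" using x h by (simp add: abs_le_square_iff[symmetric])
    then have "(1 - x\<^sup>2) powr (hi - lo) \<le> (1 - (1 - h)\<^sup>2) powr (hi - lo)"
      using x square_le_1[of x] lohi by (intro powr_mono2) auto
    then show ?thesis unfolding diff[OF x(1)] D_def by (intro mult_left_mono) auto
  qed
  have \<phi>0: "\<phi> x = 0" if "\<bar>x\<bar> < 1 - h" for x using that by (simp add: \<phi>_def)
  have \<phi>le: "\<phi> x \<le> gweight hi x" "\<phi> x \<le> gweight lo x" "\<phi> x \<ge> 0" if x: "x \<in> {-1..1}" for x
  proof -
    have "max 0 (\<bar>x\<bar> - (1 - h)) \<le> 1" using x h by auto
    then have "\<phi> x \<le> gweight A x * 1" unfolding \<phi>_def by (intro mult_left_mono) auto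
    then show "\<phi> x \<le> gweight hi x" using gweight_antimono[of hi A x] lohi x by auto
    moreover have "gweight hi x \<le> gweight lo x" using gweight_antimono[of lo hi x] lohi x by auto
    ultimately show "\<phi> x \<le> gweight lo x" by simp
    show "\<phi> x \<ge> 0" by (simp add: \<phi>_def)
  qed
  \<comment> \<open>Both integrands have the same minorant up to the factor \<open>D\<close>.
    However small \<open>D\<close> becomes as \<open>hi\<close> approaches \<open>lo\<close>, it
    only scales the bound, and the condition \<open>small\<close> is free of it.\<close>
  have low: "\<kappa> * \<phi> x - \<epsilon> \<le> g x * gweight hi x"
    and low': "D * (\<kappa> * \<phi> x - \<epsilon>) \<le> g x * (gweight lo x - gweight hi x)" if x: "x \<in> {-1..1}" for x
  proof -
    have d0: "gweight lo x - gweight hi x \<ge> 0" using gweight_antimono[of lo hi x] lohi x by auto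
    have w1: "gweight hi x \<le> 1" using gweight_le_1[of hi x] lohi x by auto
    show "\<kappa> * \<phi> x - \<epsilon> \<le> g x * gweight hi x"
    proof (cases "\<bar>x\<bar> < 1 - h")
      case True
      have "- \<epsilon> \<le> - \<epsilon> * gweight hi x" using mult_left_mono[OF w1 \<epsilon>] by simp
      also have "\<dots> \<le> g x * gweight hi x" by (intro mult_right_mono glow x) auto
      finally show ?thesis using \<phi>0[OF True] by simp
    next
      case False
      then have "\<kappa> * gweight hi x \<le> g x * gweight hi x" using x by (intro mult_right_mono gend) auto
      moreover have "\<kappa> * \<phi> x \<le> \<kappa> * gweight hi x" using \<kappa> \<phi>le[OF x] by (intro mult_left_mono) auto
      ultimately show ?thesis using \<epsilon> by simp
    qed
    show "D * (\<kappa> * \<phi> x - \<epsilon>) \<le> g x * (gweight lo x - gweight hi x)"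
    proof (cases "\<bar>x\<bar> < 1 - h")
      case True
      have "- \<epsilon> * D \<le> - \<epsilon> * (gweight lo x - gweight hi x)"
        using mult_left_mono[OF inner[OF x True] \<epsilon>] by simp
      also have "\<dots> \<le> g x * (gweight lo x - gweight hi x)" by (intro mult_right_mono glow x d0)
      finally show ?thesis using \<phi>0[OF True] by (simp add: mult.commute)
    next
      case False
      have "D * (\<kappa> * \<phi> x - \<epsilon>) \<le> \<kappa> * (\<phi> x * D)" using D \<epsilon> by (simp add: algebra_simps)
      also have "\<dots> \<le> \<kappa> * (gweight lo x * D)"
        using \<kappa> D \<phi>le[OF x] by (intro mult_left_mono mult_right_mono) auto
      also have "\<dots> \<le> \<kappa> * (gweight lo x - gweight hi x)"
        using \<kappa> False x by (intro mult_left_mono outer) auto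
      also have "\<dots> \<le> g x * (gweight lo x - gweight hi x)"
        using False x by (intro mult_right_mono gend d0) auto
      finally show ?thesis .
    qed
  qed
  have A: "A \<ge> 0" using lohi by simp
  have c\<phi>: "continuous_on {-1..1} \<phi>"
    unfolding \<phi>_def by (intro continuous_intros continuous_on_gweight[OF A])
  have chi: "continuous_on {-1..1} (\<lambda>x. g x * gweight hi x)"
    and clo: "continuous_on {-1..1} (\<lambda>x. g x * gweight lo x)"
    by (intro continuous_intros g continuous_on_gweight; use lohi in simp)+
  have "((\<lambda>x. \<kappa> * \<phi> x - \<epsilon>) has_integral \<kappa> * integral {-1..1} \<phi> - (1 - (-1)) *\<^sub>R \<epsilon>) {-1..1}"
    using has_integral_const_real[of \<epsilon> "-1" 1]
    by (intro has_integral_diff has_integral_mult_right integrable_integral integrable_continuous_real c\<phi>) simp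
  then have base: "((\<lambda>x. \<kappa> * \<phi> x - \<epsilon>) has_integral \<kappa> * integral {-1..1} \<phi> - 2 * \<epsilon>) {-1..1}" by simp
  have pos: "\<kappa> * integral {-1..1} \<phi> - 2 * \<epsilon> > 0" using small by (simp add: \<phi>_def[abs_def])
  have "\<kappa> * integral {-1..1} \<phi> - 2 * \<epsilon> \<le> integral {-1..1} (\<lambda>x. g x * gweight hi x)"
    by (rule has_integral_le[OF base integrable_integral[OF integrable_continuous_real[OF chi]]]) (rule low)
  with pos show "0 < integral {-1..1} (\<lambda>x. g x * gweight hi x)" by simp
  have "((\<lambda>x. g x * (gweight lo x - gweight hi x)) has_integral
      integral {-1..1} (\<lambda>x. g x * gweight lo x) - integral {-1..1} (\<lambda>x. g x * gweight hi x)) {-1..1}"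
    unfolding right_diff_distrib
    by (intro has_integral_diff integrable_integral integrable_continuous_real chi clo)
  from has_integral_le[OF has_integral_mult_right[OF base, of D] this low']
  have "D * (\<kappa> * integral {-1..1} \<phi> - 2 * \<epsilon>)
      \<le> integral {-1..1} (\<lambda>x. g x * gweight lo x) - integral {-1..1} (\<lambda>x. g x * gweight hi x)" .
  moreover have "0 \<le> D * (\<kappa> * integral {-1..1} \<phi> - 2 * \<epsilon>)" using D pos by (intro mult_nonneg_nonneg) auto
  ultimately show "integral {-1..1} (\<lambda>x. g x * gweight hi x) \<le> integral {-1..1} (\<lambda>x. g x * gweight lo x)"
    by linarith
qed

lemma integral_gweight_bump_pos:
  assumes "A \<ge> 0" "0 < h" "h < 1"
  shows "integral {-1..1} (\<lambda>x. gweight A x * max 0 (\<bar>x\<bar> - (1 - h))) > 0"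
proof -
  let ?\<phi> = "\<lambda>x. gweight A x * max 0 (\<bar>x\<bar> - (1 - h))"
  have c: "continuous_on {-1..1} ?\<phi>" by (intro continuous_intros continuous_on_gweight assms)
  have "?\<phi> (1 - h / 2) > 0" using assms by (intro mult_pos_pos gweight_pos) auto
  moreover have "1 - h / 2 \<in> {-1..1}" using assms by auto
  ultimately have "integral {-1..1} ?\<phi> \<noteq> 0"
    using integral_eq_0_iff[OF c] by fastforce
  moreover have "integral {-1..1} ?\<phi> \<ge> 0"
    by (rule integral_nonneg[OF integrable_continuous_real[OF c]]) auto
  ultimately show ?thesis by simp
qed

lemma gpswf_radial_1 [simp]: "gpswf_radial c a n r 1 = 1"
  by (simp add: gpswf_radial_def parity_ext_def)

text \<open>The common index makes the parity signs cancel, so closeness of products only has to be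
  examined on the right half.\<close>

lemma gpswf_radial_mult: "gpswf_radial c a n r x * gpswf_radial c b n s x = radial c r a \<bar>x\<bar> * radial c s b \<bar>x\<bar>"
proof -
  have "(- 1 :: real) ^ n * (- 1) ^ n = 1" by (simp flip: power_mult_distrib)
  then show ?thesis by (auto simp: gpswf_radial_def parity_ext_def)
qed

lemma transform_eigenvalue_antimono:
  assumes \<theta>: "prufer_angle c \<theta>" and ab: "0 \<le> b" "b < a" and cont: "continuous_on {b..a} \<kappa>"
    and angle: "\<And>t. t \<in> {b..a} \<Longrightarrow> \<theta> (\<kappa> t) t = real n * (pi / 2)"
    and K: "\<And>t. (K has_real_derivative K' t) (at t)" and K': "\<And>t. (K' has_real_derivative - K t) (at t)"
    and k: "transform_eigenvalue K c a (gpswf_radial c a n (\<kappa> a)) k"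
    and l: "transform_eigenvalue K c b (gpswf_radial c b n (\<kappa> b)) l"
  shows "\<bar>k\<bar> \<le> \<bar>l\<bar>"
proof -
  define f where "f t = gpswf_radial c t n (\<kappa> t)" for t
  define u where "u t = radial c (\<kappa> t) t" for t
  \<comment> \<open>Since \<open>f t 1 = 1\<close>, the eigenvalue equation at \<open>x = 1\<close>
    reads off the eigenvalue.\<close>
  define M where "M t = integral {-1..1} (\<lambda>y. K (c * 1 * y) * (f t y * gweight t y))" for t
  have M_unique: "m = M t" if "transform_eigenvalue K c t (f t) m" for m t
    using bspec[OF that[unfolded transform_eigenvalue_def], of 1] by (simp add: M_def f_def)
  have nonneg: "t \<ge> 0" if "t \<in> {b..a}" for t using that ab by auto
  have M: "transform_eigenvalue K c t (f t) (M t)" if t: "t \<in> {b..a}" for t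
  proof -
    obtain m where m: "transform_eigenvalue K c t (f t) m"
      unfolding f_def by (rule transform_eigenvalue_exists[OF \<theta> nonneg[OF t] angle[OF t] K K', rule_format])
    then show ?thesis using M_unique[OF m] by simp
  qed
  have cf: "continuous_on {-1..1} (f t)" if t: "t \<in> {b..a}" for t
    unfolding f_def by (rule prolate_ode_continuous(1)[OF prolate_ode_gpswf_radial[OF \<theta> nonneg[OF t] angle[OF t]]])
  have cK: "continuous_on UNIV K"
    using K by (intro continuous_at_imp_continuous_on) (blast intro: DERIV_isCont)
  have ff: "f s x * f t x = u s \<bar>x\<bar> * u t \<bar>x\<bar>" for s t x
    by (simp add: f_def u_def gpswf_radial_mult)
  have "uniformly_continuous_on ({b..a} \<times> {0..1}) (\<lambda>z. u (fst z) (snd z))"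
    unfolding u_def
    by (intro compact_uniformly_continuous continuous_on_radial_param(1) cont continuous_intros compact_Times)
       (use nonneg in auto)
  then have unif: "\<exists>d>0. \<forall>s\<in>{b..a}. \<forall>t\<in>{b..a}. \<bar>s - t\<bar> < d \<longrightarrow> (\<forall>x\<in>{0..1}. \<bar>u s x - u t x\<bar> < e)" if "e > 0" for e
  proof -
    obtain d where d: "d > 0" "\<And>z z'. z \<in> {b..a} \<times> {0..1} \<Longrightarrow> z' \<in> {b..a} \<times> {0..1} \<Longrightarrow>
        dist z' z < d \<Longrightarrow> dist (u (fst z') (snd z')) (u (fst z) (snd z)) < e"
      using \<open>uniformly_continuous_on _ _\<close> \<open>e > 0\<close> unfolding uniformly_continuous_on_def by metis
    have "\<bar>u s x - u t x\<bar> < e" if "s \<in> {b..a}" "t \<in> {b..a}" "\<bar>s - t\<bar> < d" "x \<in> {0..1}" for s t x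
      using d(2)[of "(t, x)" "(s, x)"] that by (simp add: dist_Pair_Pair dist_real_def)
    then show ?thesis using d(1) by blast
  qed
  have "\<bar>M a\<bar> \<le> \<bar>M b\<bar>"
  proof (rule local_order_imp_global[where R = "\<lambda>x y. \<bar>M y\<bar> \<le> \<bar>M x\<bar>"])
    fix t assume t: "t \<in> {b..a}"
    have cu: "continuous_on {0..1} (u t)"
      unfolding u_def by (rule prolate_ode_continuous(1)[OF prolate_ode_radial_right[OF nonneg[OF t]]])
    obtain d0 where d0: "d0 > 0" "\<And>x. x \<in> {0..1} \<Longrightarrow> \<bar>x - 1\<bar> < d0 \<Longrightarrow> \<bar>u t x - u t 1\<bar> < 1 / 2"
      using cu[unfolded continuous_on_iff, rule_format, of 1 "1 / 2"] by (auto simp: dist_real_def)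
    \<comment> \<open>Within \<open>h\<close> of the endpoint, \<open>u t\<close> stays above
      1/2.\<close>
    define h where "h = min (d0 / 2) (1 / 2)"
    have h: "0 < h" "h < 1" "h < d0" using d0(1) by (auto simp: h_def)
    have uend: "u t x \<ge> 1 / 2" if "x \<in> {0..1}" "x \<ge> 1 - h" for x
    proof -
      have "\<bar>u t x - u t 1\<bar> < 1 / 2" by (rule d0(2)) (use that h in auto)
      moreover have "u t 1 = 1" by (simp add: u_def)
      ultimately show ?thesis by linarith
    qed
    have "bounded (u t ` {0..1})"
      by (rule compact_imp_bounded[OF compact_continuous_image[OF cu compact_Icc]])
    then obtain B where "\<forall>y\<in>u t ` {0..1}. norm y \<le> B" unfolding bounded_iff by blast
    then have B: "\<And>x. x \<in> {0..1} \<Longrightarrow> \<bar>u t x\<bar> \<le> B" by (metis imageI real_norm_def)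
    have B0: "B \<ge> 0" using B[of 0] by auto
    define I where "I = integral {-1..1} (\<lambda>x. gweight a x * max 0 (\<bar>x\<bar> - (1 - h)))"
    have I: "I > 0" unfolding I_def by (rule integral_gweight_bump_pos) (use ab h in auto)
    \<comment> \<open>The bound 1/4 leaves a nearby \<open>u s\<close> at least 1/4 at the ends, so
      the product there is at least 1/8; the other bound makes twice the defect \<open>e * B\<close>
      at most \<open>I / 16\<close>, below \<open>I / 8\<close>. Since \<open>I\<close> is taken
      with the largest exponent \<open>a\<close>, one choice serves all \<open>s\<close>.\<close>
    define e where "e = min (1 / 4) (I / (32 * (B + 1)))"
    have e: "e > 0" using I B0 by (auto simp: e_def)
    have e4: "e \<le> 1 / 4" and eI: "e \<le> I / (32 * (B + 1))"
      unfolding e_def by (rule min.cobounded1, rule min.cobounded2)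
    have eB: "2 * (e * B) < 1 / 8 * I"
    proof -
      have "e * B \<le> I / (32 * (B + 1)) * (B + 1)" using eI B0 I by (intro mult_mono) auto
      also have "\<dots> = I / 32" using B0 by (simp add: field_simps)
      finally show ?thesis using I by simp
    qed
    obtain d where d: "d > 0"
      "\<And>s. s \<in> {b..a} \<Longrightarrow> \<bar>s - t\<bar> < d \<Longrightarrow> \<forall>x\<in>{0..1}. \<bar>u s x - u t x\<bar> < e"
      using unif[OF e] t by blast
    have step: "(t < s \<longrightarrow> \<bar>M s\<bar> \<le> \<bar>M t\<bar>) \<and> (s < t \<longrightarrow> \<bar>M t\<bar> \<le> \<bar>M s\<bar>)"
      if s: "s \<in> {b..a}" "\<bar>s - t\<bar> < d" for s
    proof -
      define g where "g x = f s x * f t x" for x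
      have cg: "continuous_on {-1..1} g" unfolding g_def by (intro continuous_intros cf s t)
      have close: "\<bar>u s \<bar>x\<bar> - u t \<bar>x\<bar>\<bar> < e" if "x \<in> {-1..1}" for x
        using d(2)[OF s] that by auto
      have glow: "g x \<ge> - (e * B)" if x: "x \<in> {-1..1}" for x
      proof -
        have "\<bar>(u s \<bar>x\<bar> - u t \<bar>x\<bar>) * u t \<bar>x\<bar>\<bar> \<le> e * B"
          unfolding abs_mult using close[OF x] B[of "\<bar>x\<bar>"] x by (intro mult_mono) auto
        moreover have "g x = u t \<bar>x\<bar> * u t \<bar>x\<bar> + (u s \<bar>x\<bar> - u t \<bar>x\<bar>) * u t \<bar>x\<bar>"
          unfolding g_def ff by (simp add: algebra_simps)
        ultimately show ?thesis using zero_le_square[of "u t \<bar>x\<bar>"] by linarith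
      qed
      have gend: "g x \<ge> 1 / 8" if x: "x \<in> {-1..1}" "\<bar>x\<bar> \<ge> 1 - h" for x
      proof -
        have 1: "u t \<bar>x\<bar> \<ge> 1 / 2" using uend[of "\<bar>x\<bar>"] x by auto
        have 2: "u s \<bar>x\<bar> \<ge> 1 / 4" using close[OF x(1)] 1 e4 by auto
        have "(1 / 4) * (1 / 2) \<le> u s \<bar>x\<bar> * u t \<bar>x\<bar>" using 1 2 by (intro mult_mono) auto
        then show ?thesis by (simp add: g_def ff)
      qed
      have eB0: "e * B \<ge> 0" using e B0 by simp
      note compare = integral_gweight_compare[OF cg _ _ _ h(1,2) _ eB0 glow gend eB[unfolded I_def]]
      have swap: "M s * integral {-1..1} (\<lambda>x. g x * gweight t x) = M t * integral {-1..1} (\<lambda>x. g x * gweight s x)"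
        unfolding g_def
        by (rule transform_eigenvalue_swap[OF M[OF s(1)] cf[OF s(1)] nonneg[OF s(1)] M[OF t] cf[OF t] nonneg[OF t] cK])
      \<comment> \<open>Holds for vanishing \<open>p\<close> or \<open>q\<close> as well, which
        occurs for whichever of \<open>cos\<close> and \<open>sin\<close> has the wrong
        parity.\<close>
      have order: "\<bar>p\<bar> \<le> \<bar>q\<bar>" if "p * y = q * x" "0 < x" "x \<le> y" for p q x y :: real
      proof -
        have "\<bar>p\<bar> * y = \<bar>q\<bar> * x" using that by (metis abs_mult abs_of_pos less_le_trans)
        also have "\<dots> \<le> \<bar>q\<bar> * y" using that by (intro mult_left_mono) auto
        finally show ?thesis using that by (simp add: mult_le_cancel_right)
      qed
      show ?thesis
      proof (intro conjI impI)
        assume "t < s"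
        then show "\<bar>M s\<bar> \<le> \<bar>M t\<bar>" using order[OF swap] compare[of t s] s t ab by auto
      next
        assume "s < t"
        then show "\<bar>M t\<bar> \<le> \<bar>M s\<bar>" using order[OF swap[symmetric]] compare[of s t] s t ab by auto
      qed
    qed
    show "\<exists>d>0. \<forall>y\<in>{b..a}. \<bar>y - t\<bar> < d \<longrightarrow> (t < y \<longrightarrow> \<bar>M y\<bar> \<le> \<bar>M t\<bar>) \<and> (y < t \<longrightarrow> \<bar>M t\<bar> \<le> \<bar>M y\<bar>)"
      by (rule exI[of _ d]) (use step d(1) in auto)
  qed (use ab in auto)
  moreover have "k = M a" "l = M b" using k l M_unique by (auto simp: f_def)
  ultimately show ?thesis by simp
qed

section \<open>Return to the complex Fourier eigenvalue\<close>

lemma finite_fourier_real: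
  assumes f: "continuous_on {-1..1} f" and a: "a \<ge> 0"
  shows "finite_fourier a c (\<lambda>y. complex_of_real (f y)) x =
     complex_of_real (integral {-1..1} (\<lambda>y. cos (c * x * y) * (f y * gweight a y)))
     + \<i> * complex_of_real (integral {-1..1} (\<lambda>y. sin (c * x * y) * (f y * gweight a y)))"
proof -
  let ?E = "\<lambda>y. exp (\<i> * complex_of_real (c * x * y)) * complex_of_real (f y)"
  let ?F = "\<lambda>y. ?E y * complex_of_real (gweight a y)"
  have cF: "continuous_on {-1..1} ?F" by (intro continuous_intros f continuous_on_gweight a)
  have "finite_fourier a c (\<lambda>y. complex_of_real (f y)) x
      = (LBINT y=ereal (-1)..ereal 1. ?E y * complex_of_real (jacobi_weight a y))"
    unfolding finite_fourier_def by (rule interval_integral_Icc[symmetric]) simp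
  \<comment> \<open>On the open interval \<open>jacobi_weight\<close> and \<open>gweight\<close>
    agree; they differ only at the endpoints for exponent 0.\<close>
  also have "\<dots> = (LBINT y=ereal (-1)..ereal 1. ?F y)"
    by (rule interval_integral_cong) (auto simp: einterval_def gweight_eq_jacobi_weight)
  also have "\<dots> = (LINT y:{-1..1}|lborel. ?F y)"
    by (rule interval_integral_Icc) simp
  also have "\<dots> = integral {-1..1} ?F"
    by (rule set_borel_integral_eq_integral(2)[OF borel_integrable_atLeastAtMost'[OF cF]])
  also have "?F = (\<lambda>y. complex_of_real (cos (c * x * y) * (f y * gweight a y))
      + \<i> * complex_of_real (sin (c * x * y) * (f y * gweight a y)))"
    by (simp add: fun_eq_iff exp_Euler cos_of_real sin_of_real algebra_simps
        flip: of_real_mult)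
  also have "integral {-1..1} \<dots> = complex_of_real (integral {-1..1} (\<lambda>y. cos (c * x * y) * (f y * gweight a y)))
     + \<i> * complex_of_real (integral {-1..1} (\<lambda>y. sin (c * x * y) * (f y * gweight a y)))"
    by (intro integral_unique has_integral_add has_integral_mult_right
        has_integral_linear[OF integrable_integral bounded_linear_of_real, unfolded o_def]
        integrable_continuous_real continuous_intros f continuous_on_gweight a)
  finally show ?thesis .
qed

text \<open>\<open>f\<close> is a multiple of \<open>gpswf_radial\<close>, and the factor cancels in
  the eigenvalue equation. A point with \<open>f x0 \<noteq> 0\<close> makes the definite
  description unique.\<close>

lemma fourier_eigenvalue_eq:
  assumes \<theta>: "prufer_angle c \<theta>" and a: "a \<ge> 0" and n: "\<theta> r a = real n * (pi / 2)"
    and f: "prolate_eigenfunction a c r f"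
    and k: "transform_eigenvalue cos c a (gpswf_radial c a n r) k"
    and l: "transform_eigenvalue sin c a (gpswf_radial c a n r) l"
  shows "fourier_eigenvalue a c f = Complex k l"
proof -
  obtain f' x0 where ode: "prolate_ode c a r {-1..1} f f'" and x0: "x0 \<in> {-1..1}" "f x0 \<noteq> 0"
    using f unfolding prolate_eigenfunction_iff by blast
  obtain m where m: "\<And>x. x \<in> {-1..1} \<Longrightarrow> f x = m * gpswf_radial c a n r x"
    by (rule prolate_ode_multiple[OF \<theta> a n ode], rule that)
  have scale: "integral {-1..1} (\<lambda>y. K (c * x * y) * (f y * gweight a y)) = j * f x"
    if K: "transform_eigenvalue K c a (gpswf_radial c a n r) j" and x: "x \<in> {-1..1}" for K j x
  proof -
    have "integral {-1..1} (\<lambda>y. K (c * x * y) * (f y * gweight a y))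
        = integral {-1..1} (\<lambda>y. m * (K (c * x * y) * (gpswf_radial c a n r y * gweight a y)))"
      by (intro integral_cong) (simp add: m)
    also have "\<dots> = m * (j * gpswf_radial c a n r x)"
      using K x by (simp add: transform_eigenvalue_def)
    finally show ?thesis using m[OF x] by simp
  qed
  have F: "finite_fourier a c (\<lambda>y. complex_of_real (f y)) x = Complex k l * complex_of_real (f x)"
    if x: "x \<in> {-1..1}" for x
    unfolding finite_fourier_real[OF prolate_ode_continuous(1)[OF ode] a] scale[OF k x] scale[OF l x]
    by (simp add: complex_eq_iff)
  show ?thesis
    unfolding fourier_eigenvalue_def
  proof (rule the_equality)
    show "\<forall>x\<in>{-1..1}. finite_fourier a c (\<lambda>y. complex_of_real (f y)) x = Complex k l * complex_of_real (f x)"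
      using F by blast
    fix \<mu> assume "\<forall>x\<in>{-1..1}. finite_fourier a c (\<lambda>y. complex_of_real (f y)) x = \<mu> * complex_of_real (f x)"
    then have "\<mu> * complex_of_real (f x0) = Complex k l * complex_of_real (f x0)"
      using F[OF x0(1)] x0(1) by metis
    then show "\<mu> = Complex k l" using x0(2) by simp
  qed
qed

theorem theorem2:
  fixes c \<alpha> \<alpha>' :: real and n :: nat
    and X X' :: "nat \<Rightarrow> real" and \<psi> \<psi>' :: "nat \<Rightarrow> real \<Rightarrow> real"
  assumes "c > 0" and "\<alpha> \<ge> \<alpha>'" and "\<alpha>' \<ge> 0"
    and "gpswf_family \<alpha> c X \<psi>" and "gpswf_family \<alpha>' c X' \<psi>'"
  shows "concentration_eigenvalue \<alpha> c \<psi> n \<le> concentration_eigenvalue \<alpha>' c \<psi>' n"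
proof -
  have \<alpha>: "\<alpha> \<ge> 0" using assms by simp
  obtain \<theta> where \<theta>: "prufer_angle c \<theta>" using prufer_angle_exists[OF assms(1)] .
  have X: "\<theta> (X n) \<alpha> = real n * (pi / 2)" and X': "\<theta> (X' n) \<alpha>' = real n * (pi / 2)"
    by (rule gpswf_family_prufer_angle[OF assms(4) \<theta> \<alpha>] gpswf_family_prufer_angle[OF assms(5) \<theta> assms(3)])+
  have \<psi>: "prolate_eigenfunction \<alpha> c (X n) (\<psi> n)" and \<psi>': "prolate_eigenfunction \<alpha>' c (X' n) (\<psi>' n)"
    using assms(4,5) by (auto simp: gpswf_family_def)
  obtain \<kappa> where \<kappa>: "continuous_on {\<alpha>'..\<alpha>} \<kappa>" "\<And>t. t \<in> {\<alpha>'..\<alpha>} \<Longrightarrow> \<theta> (\<kappa> t) t = real n * (pi / 2)"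
    using eigenvalue_branch[OF \<theta> assms(3,2) _ X] by auto
  \<comment> \<open>The branch ends at the given eigenvalues because the angle is injective in
    \<open>r\<close>.\<close>
  have ends: "\<kappa> \<alpha> = X n" "\<kappa> \<alpha>' = X' n"
    using \<kappa>(2)[of \<alpha>] \<kappa>(2)[of \<alpha>'] X X' assms(2) prufer_angle_less_iff[OF \<theta> \<alpha>] prufer_angle_less_iff[OF \<theta> assms(3)]
    by (metis atLeastAtMost_iff linorder_less_linear order_refl less_irrefl)+
  have cos: "(cos has_real_derivative - sin t) (at t)" "((\<lambda>t. - sin t) has_real_derivative - cos t) (at t)"
    and sin: "(sin has_real_derivative cos t) (at t)" "(cos has_real_derivative - sin t) (at t)" for t :: real
    by (auto intro!: derivative_eq_intros)
  obtain k where k: "transform_eigenvalue cos c \<alpha> (gpswf_radial c \<alpha> n (X n)) k"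
    by (rule transform_eigenvalue_exists[OF \<theta> \<alpha> X cos])
  obtain l where l: "transform_eigenvalue sin c \<alpha> (gpswf_radial c \<alpha> n (X n)) l"
    by (rule transform_eigenvalue_exists[OF \<theta> \<alpha> X sin])
  obtain k' where k': "transform_eigenvalue cos c \<alpha>' (gpswf_radial c \<alpha>' n (X' n)) k'"
    by (rule transform_eigenvalue_exists[OF \<theta> assms(3) X' cos])
  obtain l' where l': "transform_eigenvalue sin c \<alpha>' (gpswf_radial c \<alpha>' n (X' n)) l'"
    by (rule transform_eigenvalue_exists[OF \<theta> assms(3) X' sin])
  note eq = fourier_eigenvalue_eq[OF \<theta> \<alpha> X \<psi> k l] and eq' = fourier_eigenvalue_eq[OF \<theta> assms(3) X' \<psi>' k' l']
  have "cmod (fourier_eigenvalue \<alpha> c (\<psi> n)) \<le> cmod (fourier_eigenvalue \<alpha>' c (\<psi>' n))"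
  proof (cases "\<alpha>' = \<alpha>")
    \<comment> \<open>The two families may still contain different eigenfunctions, for instance of
      opposite sign; the Fourier eigenvalue depends only on the eigenspace.\<close>
    case True
    then have "X n = X' n" using ends by simp
    then show ?thesis
      using eq fourier_eigenvalue_eq[OF \<theta> \<alpha> X _ k l, of "\<psi>' n"] \<psi>' True by simp
  next
    case False
    then have less: "\<alpha>' < \<alpha>" using assms(2) by simp
    have "\<bar>k\<bar> \<le> \<bar>k'\<bar>" "\<bar>l\<bar> \<le> \<bar>l'\<bar>"
      using transform_eigenvalue_antimono[OF \<theta> assms(3) less \<kappa> cos, unfolded ends, OF _ k k']
        transform_eigenvalue_antimono[OF \<theta> assms(3) less \<kappa> sin, unfolded ends, OF _ l l'] by auto
    then show ?thesis
      unfolding eq eq' by (auto simp: cmod_def abs_le_square_iff intro!: add_mono)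
  qed
  then show ?thesis
    unfolding concentration_eigenvalue_def using assms(1) by (intro mult_left_mono power_mono) auto
qed

end
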